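(* For all $k,\Delta\in\mathbb N$ and each graph $G$ with $d(G)>k-1$ and $\delta(G)\ge\frac k2$ the following holds. (a) If $k\ge 10^{6}$ and $|G|\le(1+10^{-11})k$, then $G$ contains each tree $T\in\mathcal T\big(k,\frac{\sqrt k}{1000}\big)$. (b) If $k\ge 8\Delta^2$ and $G=(A,B)$ is $\frac{1}{50\Delta^2}$-bipartite (with respect to the partition $V(G)=A\cup B$) with $|A|,|B|\le\big(1+\frac1{25\Delta^2}\big)k$, then $G$ contains each tree $T\in\mathcal T(k,\Delta)$.
   Context: Graphs are finite and simple. $|G|$ is the number of vertices, $d(G)$ the average degree, and $\delta(G)$ the minimum degree of $G$. For a real number $D$, $\mathcal T(k,D)$ denotes the set of all trees $T$ with exactly $k$ edges and maximum degree $\Delta(T)\le D$. "$G$ contains $T$" means that $G$ has a (not necessarily induced) subgraph isomorphic to $T$. For $\beta>0$, a graph $H$ is $\beta$-bipartite if there is a partition $V(H)=A\cup B$ such that $e(A)+e(B)\le\beta\, e(H)$, where $e(H)$ is the number of edges of $H$ and $e(A)$, $e(B)$ are the numbers of edges of $H$ with both ends in $A$, respectively both ends in $B$; writing $G=(A,B)$ specifies such a partition. *)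

theory Defs
  imports Complex_Main "Graph_Theory.Pair_Digraph" "Graph_Theory.Digraph_Component"
    "Graph_Theory.Digraph_Isomorphism"
begin

text \<open>
  Finite simple graphs are the library's \<^locale>\<open>pair_graph\<close>s: finite, symmetric, loop-free
  digraphs without parallel arcs. Every undirected edge \<open>uv\<close> is thus represented by the two arcs
  \<open>(u, v)\<close> and \<open>(v, u)\<close>, so edges are counted through the following set of unordered pairs, while
  the degree of a vertex is its out-degree.
\<close>

definition edges :: "'a pair_pre_digraph \<Rightarrow> 'a set set" where
  "edges G = {{u, v} | u v. (u, v) \<in> parcs G}"

definition degree :: "'a pair_pre_digraph \<Rightarrow> 'a \<Rightarrow> nat" where
  "degree G v = out_degree (with_proj G) v"

definition average_degree :: "'a pair_pre_digraph \<Rightarrow> real" where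
  "average_degree G = (\<Sum>v\<in>pverts G. real (degree G v)) / real (card (pverts G))"

text \<open>The next two are meaningful only for graphs with at least one vertex.\<close>

definition min_degree :: "'a pair_pre_digraph \<Rightarrow> nat" where
  "min_degree G = Min (degree G ` pverts G)"

definition max_degree :: "'a pair_pre_digraph \<Rightarrow> nat" where
  "max_degree G = Max (degree G ` pverts G)"

text \<open>
  The library's \<^const>\<open>tree\<close> is not applicable to symmetric digraphs, where \<open>u, v, u\<close> counts as a
  cycle. The cycles of an undirected simple graph are the directed cycles with at least three arcs.
  The library's \<^const>\<open>connected\<close> includes that there is at least one vertex.
\<close>

definition is_tree :: "'a pair_pre_digraph \<Rightarrow> bool" where
  "is_tree T \<longleftrightarrow> pair_graph T \<and> connected (with_proj T) \<and>
     \<not> (\<exists>p. pre_digraph.cycle (with_proj T) p \<and> 3 \<le> length p)"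

definition trees :: "nat \<Rightarrow> real \<Rightarrow> 'a pair_pre_digraph set" where
  "trees k D = {T. is_tree T \<and> card (edges T) = k \<and> real (max_degree T) \<le> D}"

definition contains :: "'a pair_pre_digraph \<Rightarrow> 'b pair_pre_digraph \<Rightarrow> bool" where
  "contains G T \<longleftrightarrow> (\<exists>H. subgraph H (with_proj G) \<and> digraph_iso (with_proj T) H)"

definition edges_within :: "'a pair_pre_digraph \<Rightarrow> 'a set \<Rightarrow> nat" where
  "edges_within G A = card {e \<in> edges G. e \<subseteq> A}"

text \<open>\<open>G = (A, B)\<close> is \<open>\<beta>\<close>-bipartite with respect to the given partition; a part may be empty.\<close>

definition beta_bipartite :: "real \<Rightarrow> 'a pair_pre_digraph \<Rightarrow> 'a set \<Rightarrow> 'a set \<Rightarrow> bool" where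
  "beta_bipartite \<beta> G A B \<longleftrightarrow> A \<union> B = pverts G \<and> A \<inter> B = {} \<and>
     real (edges_within G A + edges_within G B) \<le> \<beta> * real (card (edges G))"

end

theory Submission
  imports Defs
begin

text \<open>
  A tree with \<open>k\<close> edges is the vertex set \<open>{0..k}\<close> with a parent function \<open>par i < i\<close>
  (\<open>tree_parent_encoding\<close>), so that embedding it greedily means choosing the images of
  \<open>0, 1, 2, \<dots>\<close> one after the other, each adjacent to the image of the parent and different from
  the images chosen before.

  Part (b). Counting edges shows that fewer than \<open>k\<^sup>2 / (5 \<Delta>\<^sup>2)\<close> of the pairs between \<open>A\<close> and \<open>B\<close>
  are nonadjacent. Call a vertex good if it misses at most \<open>k / (2\<Delta>)\<close> vertices of the other part. Each
  colour class of the tree meets all \<open>k\<close> edges, hence has at least \<open>k / \<Delta>\<close> vertices, hence the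
  other one has at most \<open>k + 1 - k / \<Delta>\<close>. The slack \<open>k / \<Delta>\<close> pays for the bad vertices of a part and
  for the good ones missed by a single good vertex (\<open>bipartite_room\<close>), so the greedy embedding
  into the good vertices, one colour class to each part, never gets stuck.

  Part (a). Let \<open>D = |G| - k \<ge> 1\<close>. The hypothesis on the average degree says exactly that the
  average number of nonneighbours of a vertex is less than \<open>D\<close>, and \<open>D\<close> is a tiny fraction of \<open>k\<close>.
  The tree may span \<open>G\<close>, but a greedy embedding can fail only near its end. Some set \<open>M\<close> of
  independent tree vertices is kept for the end and placed by Hall's theorem
  (\<open>complete_placement\<close>): since \<open>|M| + D - 1\<close> vertices of \<open>G\<close> are left over, Hall's condition
  fails only if there is a set \<open>Z\<close> of at least \<open>D\<close> left-over vertices and a set \<open>S\<close> comprising nearly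
  all of \<open>M\<close> such that no vertex of \<open>S\<close> can be placed on a vertex of \<open>Z\<close>. Let \<open>h\<close> be about
  \<open>k / 10000\<close>.

  If the tree has at least \<open>100 h\<close> leaves, these form \<open>M\<close>; then every parent of a leaf in \<open>S\<close> has
  all of \<open>Z\<close> among its nonneighbours. Call vertices with fewer than \<open>D\<close> nonneighbours low.
  If there are at least \<open>10 h\<close> low vertices, the parents of \<open>h + 1\<close> leaves are placed on low
  vertices; one of these leaves is in \<open>S\<close>, which contradicts \<open>|Z| \<ge> D\<close>
  (\<open>hosts_many_leaves_many_low\<close>). If there are fewer low vertices, the average forces the complement
  of \<open>G\<close> to be almost \<open>D\<close>-regular, the total excess of the nonneighbour counts over \<open>D\<close> being
  below \<open>10 h D\<close>. Double counting then gives that \<open>Z\<close> lies in a set \<open>R\<close> of at most \<open>3 D\<close> vertices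
  that is determined by the images of an initial segment of the tree, and that nearly all vertices of \<open>G\<close> have
  fewer than \<open>D\<close> nonneighbours in \<open>R\<close>; placing all later parents on these excludes \<open>Z\<close>
  (\<open>hosts_many_leaves_few_low\<close>).

  If the tree has fewer than \<open>100 h\<close> leaves, nearly all of its vertices lie on bare paths, so there
  are many disjoint paths \<open>a, m, c\<close> in which \<open>m\<close> has no further neighbours. The at most \<open>h\<close> vertices
  of \<open>G\<close> with more than \<open>h\<close> nonneighbours are used as images of such middle vertices \<open>m\<close> early on;
  this is possible as they have degree at least \<open>k / 2\<close> and the paths are taken among the
  first \<open>0.4 k\<close> tree vertices. The other middle vertices form \<open>M\<close>, and
  Hall's condition holds because all vertices involved have at most \<open>h\<close> nonneighbours
  (\<open>hosts_few_leaves\<close>).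
\<close>

section \<open>Trees as parent functions\<close>

definition children :: "nat \<Rightarrow> (nat \<Rightarrow> nat) \<Rightarrow> nat \<Rightarrow> nat set" where
  "children k par v = {i \<in> {1..k}. par i = v}"

text \<open>
  \<open>hosts V E k par\<close>: the graph \<open>(V, E)\<close> has a subgraph isomorphic to the tree given by \<open>par\<close>.
\<close>

definition hosts :: "'a set \<Rightarrow> 'a rel \<Rightarrow> nat \<Rightarrow> (nat \<Rightarrow> nat) \<Rightarrow> bool" where
  "hosts V E k par \<longleftrightarrow> (\<exists>f. inj_on f {..k} \<and> f ` {..k} \<subseteq> V \<and> (\<forall>i\<in>{1..k}. (f (par i), f i) \<in> E))"

context pair_graph
begin

lemma reachable_crosses_boundary:
  assumes "u \<rightarrow>\<^sup>*\<^bsub>with_proj G\<^esub> w" "u \<in> S" "w \<notin> S"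
  obtains x y where "(x, y) \<in> parcs G" "x \<in> S" "y \<notin> S"
proof -
  have "w \<in> S \<or> (\<exists>x y. (x, y) \<in> parcs G \<and> x \<in> S \<and> y \<notin> S)"
    using assms(1,2)
  proof (induct rule: reachable_induct)
    case base then show ?case by simp
  next
    case (step x y) then show ?case by auto
  qed
  with assms(3) that show thesis by blast
qed

lemma connected_reachable:
  assumes "connected (with_proj G)" "u \<in> pverts G" "w \<in> pverts G"
  shows "u \<rightarrow>\<^sup>*\<^bsub>with_proj G\<^esub> w"
proof -
  have "with_proj (mk_symmetric (with_proj G)) = with_proj G"
    using arcs_symmetric by (auto simp: mk_symmetric_def with_proj_def)
  with assms show ?thesis by (auto simp: connected_def strongly_connected_def)
qed

text \<open>
  A search order: as long as not all vertices are listed, connectedness yields an arc that leaves the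
  set of the listed ones, and its end can be listed next.
\<close>

lemma connected_search_order:
  assumes "connected (with_proj G)" "card (pverts G) = Suc n"
  obtains v par where "bij_betw v {..n} (pverts G)"
    "\<And>i. i \<in> {1..n} \<Longrightarrow> par i < i \<and> (v (par i), v i) \<in> parcs G"
proof -
  have "\<exists>v par. inj_on v {..m} \<and> v ` {..m} \<subseteq> pverts G \<and>
      (\<forall>i\<in>{1..m}. par i < i \<and> (v (par i), v i) \<in> parcs G)" if "m \<le> n" for m
    using that
  proof (induct m)
    case 0
    obtain r where "r \<in> pverts G" using assms(2) by (metis card.empty equals0I nat.distinct(1))
    then show ?case by (intro exI[of _ "\<lambda>_. r"]) auto
  next
    case (Suc m)
    then obtain v par where vp: "inj_on v {..m}" "v ` {..m} \<subseteq> pverts G"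
      "\<forall>i\<in>{1..m}. par i < i \<and> (v (par i), v i) \<in> parcs G" by auto
    have "card (v ` {..m}) < card (pverts G)"
      using vp(1) Suc.prems assms(2) by (simp add: card_image)
    then obtain w where w: "w \<in> pverts G" "w \<notin> v ` {..m}"
      using vp(2) by (metis order_less_irrefl subset_antisym subsetI)
    have r: "v 0 \<rightarrow>\<^sup>*\<^bsub>with_proj G\<^esub> w" using vp(2) w(1) by (intro connected_reachable assms) auto
    obtain x y where xy: "(x, y) \<in> parcs G" "x \<in> v ` {..m}" "y \<notin> v ` {..m}"
      by (rule reachable_crosses_boundary[OF r _ w(2)]) auto
    then obtain j where j: "j \<le> m" "x = v j" by auto
    let ?v = "v(Suc m := y)" and ?par = "par(Suc m := j)"
    have "inj_on ?v {..Suc m}" using vp(1) xy(3) by (auto simp: inj_on_def)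
    moreover have "?v ` {..Suc m} \<subseteq> pverts G" using vp(2) in_arcsD2[OF xy(1)] by auto
    moreover have "\<forall>i\<in>{1..Suc m}. ?par i < i \<and> (?v (?par i), ?v i) \<in> parcs G"
    proof
      fix i assume i: "i \<in> {1..Suc m}"
      show "?par i < i \<and> (?v (?par i), ?v i) \<in> parcs G"
      proof (cases "i = Suc m")
        case True then show ?thesis using j xy(1) by auto
      next
        case False
        with i vp(3) have "par i < i \<and> (v (par i), v i) \<in> parcs G" by auto
        with False i show ?thesis by auto
      qed
    qed
    ultimately show ?case by blast
  qed
  from this[of n] obtain v par where vp: "inj_on v {..n}" "v ` {..n} \<subseteq> pverts G"
      "\<forall>i\<in>{1..n}. par i < i \<and> (v (par i), v i) \<in> parcs G" by auto
  have "v ` {..n} = pverts G"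
    using vp(1,2) assms(2) pair_finite_verts by (intro card_subset_eq) (auto simp: card_image)
  with vp show thesis by (intro that[of v par]) (auto simp: bij_betw_def)
qed

text \<open>
  A path that avoids an edge but joins its ends closes with this edge to a cycle; the path has
  at least two arcs, so the cycle has at least three.
\<close>

lemma acyclic_arc_is_bridge:
  assumes acyc: "\<not> (\<exists>p. cycle p \<and> 3 \<le> length p)" and uw: "(u, w) \<in> parcs G"
  shows "\<not> u \<rightarrow>\<^sup>*\<^bsub>with_proj (G\<lparr>parcs := parcs G - {(u, w), (w, u)}\<rparr>)\<^esub> w"
proof
  let ?H = "G\<lparr>parcs := parcs G - {(u, w), (w, u)}\<rparr>"
  assume r: "u \<rightarrow>\<^sup>*\<^bsub>with_proj ?H\<^esub> w"
  interpret H: pair_wf_digraph ?H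
    using wellformed' by unfold_locales auto
  from r obtain p where p: "H.apath u p w" by (auto simp: H.reachable_apath)
  have "u \<noteq> w" using uw pair_no_loops by force
  have awp: "awalk u p w" and dist: "distinct (pawalk_verts u p)" and uwp: "(u, w) \<notin> set p"
    using p by (auto simp: H.apath_def H.awalk_def awalk_def)
  have len: "2 \<le> length p"
  proof (rule ccontr)
    assume "\<not> 2 \<le> length p"
    then consider "p = []" | a b where "p = [(a, b)]"
      by (cases p; cases "tl p") auto
    then show False using awp \<open>u \<noteq> w\<close> uwp by cases (auto simp: awalk_def)
  qed
  let ?c = "(w, u) # p"
  have "cycle ?c" unfolding cycle_def
    using awp dist arcs_symmetric[OF uw] wellformed'[OF uw]
    by (intro exI[of _ w]) (auto simp: awalk_def)
  with len acyc show False by (auto intro: exI[of _ ?c])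
qed

end

text \<open>
  The arcs of a search order already connect everything. Any further edge would therefore not be a
  bridge, so a tree consists of the edges of its search order alone, and the number of
  vertices exceeds the number of edges by one.
\<close>

lemma tree_parent_encoding:
  assumes "T \<in> trees k D"
  obtains v par where "bij_betw v {..k} (pverts T)"
    "\<And>i. i \<in> {1..k} \<Longrightarrow> par i < i"
    "parcs T = (\<Union>i\<in>{1..k}. {(v (par i), v i), (v i, v (par i))})"
    "\<And>i. i \<le> k \<Longrightarrow> real (card (children k par i)) + (if i = 0 then 0 else 1) \<le> D"
proof -
  have T: "pair_graph T" "connected (with_proj T)" "card (edges T) = k" "real (max_degree T) \<le> D"
    and acyc: "\<not> (\<exists>p. pre_digraph.cycle (with_proj T) p \<and> 3 \<le> length p)"
    using assms by (auto simp: trees_def is_tree_def)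
  interpret T: pair_graph T by fact
  have "pverts T \<noteq> {}" using T(2)
    by (auto simp: connected_def strongly_connected_def mk_symmetric_def)
  then obtain n where n: "card (pverts T) = Suc n"
    using T.pair_finite_verts by (metis card_0_eq not0_implies_Suc)
  from T.connected_search_order[OF T(2) n] obtain v par where
    v: "bij_betw v {..n} (pverts T)"
    and par: "\<And>i. i \<in> {1..n} \<Longrightarrow> par i < i \<and> (v (par i), v i) \<in> parcs T" by metis
  have inj: "v i = v j \<longleftrightarrow> i = j" if "i \<le> n" "j \<le> n" for i j
    using v that by (auto simp: bij_betw_def inj_on_def)
  let ?S = "\<Union>i\<in>{1..n}. {(v (par i), v i), (v i, v (par i))}"
  have "parcs T \<subseteq> ?S"
  proof (clarify, rule ccontr)
    fix u w assume uw: "(u, w) \<in> parcs T" "(u, w) \<notin> ?S"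
    let ?H = "T\<lparr>parcs := parcs T - {(u, w), (w, u)}\<rparr>"
    interpret H: pair_graph ?H
      using T.wellformed' T.arcs_symmetric T.pair_no_loops T.pair_finite_verts T.pair_finite_arcs
      by unfold_locales (auto simp: symmetric_def intro!: symI)
    have "v i \<rightarrow>\<^sup>*\<^bsub>with_proj ?H\<^esub> v 0" if "i \<le> n" for i
      using that
    proof (induct i rule: less_induct)
      case (less i)
      show ?case
      proof (cases "i = 0")
        case True
        then show ?thesis using v by (auto simp: bij_betw_def)
      next
        case False
        then have "par i < i" "(v i, v (par i)) \<in> parcs T"
          using par[of i] less.prems T.arcs_symmetric by auto
        moreover have "(v i, v (par i)) \<notin> {(u, w), (w, u)}" using uw(2) False less.prems by force
        ultimately show ?thesis
          using less.hyps[of "par i"] less.prems by (auto intro: H.adj_reachable_trans)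
      qed
    qed
    moreover have "u \<in> v ` {..n}" "w \<in> v ` {..n}"
      using v T.wellformed'[OF uw(1)] by (auto simp: bij_betw_def)
    ultimately have "u \<rightarrow>\<^sup>*\<^bsub>with_proj ?H\<^esub> v 0" "w \<rightarrow>\<^sup>*\<^bsub>with_proj ?H\<^esub> v 0" by auto
    then have "u \<rightarrow>\<^sup>*\<^bsub>with_proj ?H\<^esub> w"
      using H.symmetric_reachable' H.reachable_trans by blast
    with T.acyclic_arc_is_bridge[OF acyc uw(1)] show False by blast
  qed
  moreover have "?S \<subseteq> parcs T" using par T.arcs_symmetric by auto
  ultimately have arcs: "parcs T = ?S" by auto
  have "edges T = (\<lambda>i. {v (par i), v i}) ` {1..n}"
    unfolding edges_def arcs by (auto simp: insert_commute)
  moreover have "inj_on (\<lambda>i. {v (par i), v i}) {1..n}"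
  proof (rule inj_onI)
    fix i j assume ij: "i \<in> {1..n}" "j \<in> {1..n}" "{v (par i), v i} = {v (par j), v j}"
    with par[of i] par[of j] show "i = j"
      by (auto simp: doubleton_eq_iff inj)
  qed
  ultimately have nk: "n = k" using T(3) by (simp add: card_image)
  have deg: "real (card (children k par i)) + (if i = 0 then 0 else 1) \<le> D" if i: "i \<le> k" for i
  proof -
    let ?N = "children k par i \<union> (if i = 0 then {} else {par i})"
    have "(\<lambda>j. (v i, v j)) ` ?N \<subseteq> out_arcs (with_proj T) (v i)"
      using i nk arcs by (fastforce simp: children_def split: if_splits)
    moreover have "inj_on (\<lambda>j. (v i, v j)) ?N"
    proof (rule inj_onI)
      fix a b assume "a \<in> ?N" "b \<in> ?N" "(v i, v a) = (v i, v b)"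
      moreover have "c \<le> n" if "c \<in> ?N" for c
        using that par[of i] i nk by (auto simp: children_def split: if_splits)
      ultimately show "a = b" using inj by auto
    qed
    ultimately have "card ?N \<le> degree T (v i)"
      unfolding degree_def out_degree_def
      by (metis T.finite_out_arcs card_image card_mono)
    also have "degree T (v i) \<le> max_degree T"
      unfolding max_degree_def using T.pair_finite_verts i nk v
      by (intro Max_ge) (auto simp: bij_betw_def)
    finally have "real (card ?N) \<le> D" using T(4) by linarith
    moreover have "par i \<notin> children k par i" if "i \<noteq> 0"
      using par[of i] par[of "par i"] that i nk by (auto simp: children_def)
    moreover have "finite (children k par i)" by (simp add: children_def)
    ultimately show ?thesis by (auto split: if_splits)
  qed
  from v arcs par deg show thesis unfolding nk by (intro that[of v par]) auto
qed

lemma hosts_contains: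
  assumes G: "pair_graph G" and T: "pair_graph T"
    and v: "bij_betw v {..k} (pverts T)"
    and arcs: "parcs T = (\<Union>i\<in>{1..k}. {(v (par i), v i), (v i, v (par i))})"
    and par: "\<And>i. i \<in> {1..k} \<Longrightarrow> par i < i"
    and h: "hosts (pverts G) (parcs G) k par"
  shows "contains G T"
proof -
  interpret G: pair_graph G by fact
  interpret T: pair_graph T by fact
  from h obtain f where f: "inj_on f {..k}" "f ` {..k} \<subseteq> pverts G"
    "\<And>i. i \<in> {1..k} \<Longrightarrow> (f (par i), f i) \<in> parcs G" by (auto simp: hosts_def)
  define g where "g = f \<circ> the_inv_into {..k} v"
  have gv: "g (v i) = f i" if "i \<le> k" for i
    using v that by (simp add: g_def bij_betw_def the_inv_into_f_f)
  have "inj_on (g \<circ> v) {..k}" using f(1) gv by (auto simp: inj_on_def)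
  then have ginj: "inj_on g (pverts T)"
    using v inj_on_imageI by (fastforce simp: bij_betw_def)
  have "g ` v ` {..k} \<subseteq> pverts G" using f(2) gv by auto
  then have gV: "g ` pverts T \<subseteq> pverts G" using v by (simp add: bij_betw_def)
  have gE: "(g a, g b) \<in> parcs G" if "(a, b) \<in> parcs T" for a b
  proof -
    from that obtain i where i: "i \<in> {1..k}" "(a, b) \<in> {(v (par i), v i), (v i, v (par i))}"
      by (auto simp: arcs)
    then have "g (v i) = f i" "g (v (par i)) = f (par i)" using par[of i] by (auto simp: gv)
    with i f(3)[of i] G.arcs_symmetric show ?thesis by auto
  qed
  let ?hom = "\<lparr>iso_verts = g, iso_arcs = map_prod g g, iso_head = snd, iso_tail = fst\<rparr>"
  let ?H = "app_iso ?hom (with_proj T)"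
  have "inj_on (map_prod g g) (parcs T)"
    using map_prod_inj_on[OF ginj ginj] T.wellformed' by (auto intro: inj_on_subset)
  then have iso: "pre_digraph.digraph_isomorphism (with_proj T) ?hom"
    using ginj by (auto simp: T.digraph_isomorphism_def T.wf_digraph)
  have "wf_digraph ?H"
    by unfold_locales (auto dest: T.wellformed')
  moreover have "arcs ?H \<subseteq> parcs G" using gE by auto
  ultimately have "subgraph ?H (with_proj G)"
    using gV G.wf_digraph by (auto simp: subgraph_def compatible_def)
  with iso show ?thesis by (auto simp: contains_def digraph_iso_def)
qed

section \<open>Systems of distinct choices\<close>

text \<open>
  The proof of Halmos and Vaughan. If some proper nonempty subfamily \<open>J\<close> is tight, its
  representatives use up all of \<open>\<Union>i\<in>J. A i\<close>, and the remaining sets satisfy Hall's condition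
  outside this union. If no such subfamily is tight, any choice of one representative preserves the
  condition for the others.
\<close>

lemma hall_marriage:
  fixes A :: "'i \<Rightarrow> 'a set"
  assumes "finite I" "\<And>i. i \<in> I \<Longrightarrow> finite (A i)"
    and "\<And>J. J \<subseteq> I \<Longrightarrow> card J \<le> card (\<Union>i\<in>J. A i)"
  obtains f where "inj_on f I" "\<And>i. i \<in> I \<Longrightarrow> f i \<in> A i"
proof -
  have "\<exists>f. inj_on f I \<and> (\<forall>i\<in>I. f i \<in> A i)"
    using assms
  proof (induct "card I" arbitrary: I A rule: less_induct)
    case less
    note fin = less.prems(1,2) and hall = less.prems(3)
    show ?case
    proof (cases "\<exists>J. J \<subset> I \<and> J \<noteq> {} \<and> card (\<Union>i\<in>J. A i) = card J")
      case True
      then obtain J where J: "J \<subset> I" "J \<noteq> {}" "card (\<Union>i\<in>J. A i) = card J" by auto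
      have "finite J" using J(1) fin(1) finite_subset by blast
      then have finJ: "finite J" "finite (\<Union>i\<in>J. A i)" using J(1) fin(2) by auto
      have "card J < card I" using J(1) fin(1) by (simp add: psubset_card_mono)
      moreover have "card K \<le> card (\<Union>i\<in>K. A i)" if "K \<subseteq> J" for K
        using that J(1) by (intro hall) auto
      ultimately have "\<exists>f. inj_on f J \<and> (\<forall>i\<in>J. f i \<in> A i)"
        using J(1) fin finJ by (intro less.hyps) auto
      then obtain f where f: "inj_on f J" "\<And>i. i \<in> J \<Longrightarrow> f i \<in> A i" by auto
      let ?A = "\<lambda>i. A i - (\<Union>i\<in>J. A i)"
      have "card (I - J) < card I"
        using J(1,2) fin(1) by (intro psubset_card_mono) auto
      moreover have "card K \<le> card (\<Union>i\<in>K. ?A i)" if K: "K \<subseteq> I - J" for K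
      proof -
        have finK: "finite K" using K fin(1) finite_subset by blast
        have "card K + card J = card (K \<union> J)"
          using K finK finJ(1) by (subst card_Un_disjoint) auto
        also have "\<dots> \<le> card (\<Union>i\<in>K \<union> J. A i)" using K J(1) by (intro hall) auto
        also have "(\<Union>i\<in>K \<union> J. A i) = (\<Union>i\<in>K. ?A i) \<union> (\<Union>i\<in>J. A i)" by auto
        also have "card \<dots> \<le> card (\<Union>i\<in>K. ?A i) + card (\<Union>i\<in>J. A i)"
          by (rule card_Un_le)
        finally show ?thesis using J(3) by simp
      qed
      ultimately have "\<exists>g. inj_on g (I - J) \<and> (\<forall>i\<in>I - J. g i \<in> ?A i)"
        using fin by (intro less.hyps) auto
      then obtain g where g: "inj_on g (I - J)" "\<And>i. i \<in> I - J \<Longrightarrow> g i \<in> ?A i" by auto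
      let ?h = "\<lambda>i. if i \<in> J then f i else g i"
      have "inj_on ?h (J \<union> (I - J))"
        using f g by (intro inj_on_disjoint_Un) fastforce+
      moreover have "J \<union> (I - J) = I" using J(1) by auto
      moreover have "\<forall>i\<in>I. ?h i \<in> A i" using f(2) g(2) by auto
      ultimately show ?thesis by (intro exI[of _ ?h]) simp
    next
      case no_tight: False
      show ?thesis
      proof (cases "I = {}")
        case True then show ?thesis by auto
      next
        case nonempty: False
        then obtain i where i: "i \<in> I" by auto
        have "A i \<noteq> {}" using hall[of "{i}"] i by auto
        then obtain x where x: "x \<in> A i" by auto
        let ?A = "\<lambda>j. A j - {x}"
        have "card (I - {i}) < card I" by (rule card_Diff1_less[OF fin(1) i])
        moreover have "card K \<le> card (\<Union>j\<in>K. ?A j)" if K: "K \<subseteq> I - {i}" for K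
        proof (cases "K = {}")
          case False
          have "K \<subset> I" using K i by auto
          with no_tight False have "card K \<noteq> card (\<Union>j\<in>K. A j)" by metis
          moreover have "card K \<le> card (\<Union>j\<in>K. A j)" using K by (intro hall) auto
          moreover have "(\<Union>j\<in>K. ?A j) = (\<Union>j\<in>K. A j) - {x}" by auto
          moreover have "finite K" using K fin(1) finite_subset by blast
          then have "finite (\<Union>j\<in>K. A j)" using K fin(2) by auto
          moreover have "card (\<Union>j\<in>K. A j) - 1 \<le> card ((\<Union>j\<in>K. A j) - {x})"
            by (simp add: card_Diff_singleton_if)
          ultimately show ?thesis by simp
        qed simp
        ultimately have "\<exists>g. inj_on g (I - {i}) \<and> (\<forall>j\<in>I - {i}. g j \<in> ?A j)"
          using fin by (intro less.hyps) auto
        then obtain g where g: "inj_on g (I - {i})" "\<And>j. j \<in> I - {i} \<Longrightarrow> g j \<in> ?A j" by auto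
        let ?h = "g(i := x)"
        have "inj_on ?h (I - {i}) = inj_on g (I - {i})" by (rule inj_on_cong) simp
        moreover have "?h i \<notin> ?h ` (I - {i})"
        proof
          assume "?h i \<in> ?h ` (I - {i})"
          then obtain j where "j \<in> I - {i}" "x = g j" by (elim imageE) simp
          with g(2)[of j] show False by simp
        qed
        ultimately have "inj_on ?h (insert i (I - {i}))" using g(1) by (simp only: inj_on_insert) simp
        then have "inj_on ?h I" using i by (simp add: insert_absorb)
        moreover have "\<forall>j\<in>I. ?h j \<in> A j" using g(2) x by auto
        ultimately show ?thesis by (intro exI[of _ ?h]) auto
      qed
    qed
  qed
  with that show thesis by blast
qed

text \<open>
  The greedy principle behind all embeddings below. The candidates \<open>A i f\<close> for the image of \<open>i\<close> may
  depend on all earlier choices, which the first assumption expresses. Indices outside \<open>I\<close> receive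
  no image.
\<close>

lemma sequential_choice:
  fixes A :: "nat \<Rightarrow> (nat \<Rightarrow> 'a) \<Rightarrow> 'a set"
  assumes local: "\<And>i f g. (\<And>j. j < i \<Longrightarrow> f j = g j) \<Longrightarrow> A i f = A i g"
    and step: "\<And>i f. i \<in> I \<Longrightarrow> (\<And>j. j < i \<Longrightarrow> j \<in> I \<Longrightarrow> f j \<in> A j f) \<Longrightarrow>
      inj_on f {j \<in> I. j < i} \<Longrightarrow> \<exists>x\<in>A i f. x \<notin> f ` {j \<in> I. j < i}"
  obtains f where "inj_on f I" "\<And>i. i \<in> I \<Longrightarrow> f i \<in> A i f"
proof -
  let ?P = "\<lambda>f i x. i \<in> I \<longrightarrow> x \<in> A i f \<and> x \<notin> f ` {j \<in> I. j < i}"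
  have inj: "inj_on f {j \<in> I. Q j}" if "\<And>j. Q j \<Longrightarrow> ?P f j (f j)" for f Q
  proof (rule linorder_inj_onI)
    fix a b assume "a < b" "a \<in> {j \<in> I. Q j}" "b \<in> {j \<in> I. Q j}"
    with that[of b] show "f a \<noteq> f b" by (metis (mono_tags, lifting) imageI mem_Collect_eq)
  qed auto
  have "\<exists>f. \<forall>i. ?P f i (f i)"
  proof (rule dependent_wellorder_choice)
    fix x :: 'a and f g :: "nat \<Rightarrow> 'a" and i :: nat
    assume "\<And>j. j < i \<Longrightarrow> f j = g j"
    then show "?P f i x = ?P g i x" using local[of i f g] by auto
  next
    fix i f assume "\<And>j. j < i \<Longrightarrow> ?P f j (f j)"
    then show "\<exists>x. ?P f i x" using step[of i f] inj[of "\<lambda>j. j < i" f] by blast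
  qed
  then obtain f where f: "\<And>i. ?P f i (f i)" by blast
  show thesis using f inj[of "\<lambda>_. True" f] by (intro that[of f]) auto
qed

section \<open>Greedy embedding into an almost complete bipartite graph\<close>

text \<open>
  The condition \<open>par i < i\<close> makes the recursion terminate for every function \<open>par\<close>.
\<close>

fun depth :: "(nat \<Rightarrow> nat) \<Rightarrow> nat \<Rightarrow> nat" where
  "depth par i = (if par i < i then Suc (depth par (par i)) else 0)"

declare depth.simps [simp del]

lemma finite_children [simp]: "finite (children k par v)"
  by (simp add: children_def)

locale parent_tree =
  fixes k :: nat and par :: "nat \<Rightarrow> nat"
  assumes par_less: "i \<in> {1..k} \<Longrightarrow> par i < i"
begin

lemma depth_par: "i \<in> {1..k} \<Longrightarrow> depth par i = Suc (depth par (par i))"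
  by (subst depth.simps) (simp add: par_less)

text \<open>
  Every edge has an end in each colour class, and no vertex lies on more than \<open>\<Delta>\<close> edges.
\<close>

lemma colour_class_ge:
  assumes deg: "\<And>i. i \<le> k \<Longrightarrow> card (children k par i) + (if i = 0 then 0 else 1) \<le> \<Delta>"
    and c: "c \<in> {0, 1}"
  shows "k \<le> \<Delta> * card {i. i \<le> k \<and> depth par i mod 2 = c}"
proof -
  let ?X = "{i. i \<le> k \<and> depth par i mod 2 = c}"
  let ?N = "\<lambda>v. children k par v \<union> (if v = 0 then {} else {v})"
  have "{1..k} \<subseteq> (\<Union>v\<in>?X. ?N v)"
  proof
    fix i assume i: "i \<in> {1..k}"
    from c have "c = 0 \<or> c = 1" by simp
    then have "Suc m mod 2 = c \<or> m mod 2 = c" for m by presburger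
    then have "depth par i mod 2 = c \<or> depth par (par i) mod 2 = c"
      unfolding depth_par[OF i] .
    then show "i \<in> (\<Union>v\<in>?X. ?N v)"
    proof
      assume "depth par i mod 2 = c"
      with i show ?thesis by (intro UN_I[of i]) simp_all
    next
      assume "depth par (par i) mod 2 = c"
      with i par_less[OF i] show ?thesis by (intro UN_I[of "par i"]) (simp_all add: children_def)
    qed
  qed
  then have "card {1..k} \<le> card (\<Union>v\<in>?X. ?N v)" by (intro card_mono) auto
  then have "k \<le> card (\<Union>v\<in>?X. ?N v)" by simp
  also have "\<dots> \<le> (\<Sum>v\<in>?X. card (?N v))" by (rule card_UN_le) auto
  also have "\<dots> \<le> (\<Sum>v\<in>?X. \<Delta>)"
  proof (rule sum_mono)
    fix v assume "v \<in> ?X"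
    then show "card (?N v) \<le> \<Delta>"
      using deg[of v] card_Un_le[of "children k par v" "{v}"] by (auto split: if_splits)
  qed
  finally show ?thesis by (simp add: mult.commute)
qed

end

text \<open>
  When \<open>i\<close> is placed, the occupied vertices on its side are images of other members of its colour
  class, so fewer than \<open>t\<close> of them.
\<close>

lemma (in parent_tree) bipartite_greedy:
  fixes V :: "'a set"
  assumes XY: "finite X" "finite Y" "X \<inter> Y = {}" "X \<union> Y \<subseteq> V" "X \<noteq> {}"
    and classes: "\<And>c. c \<in> {0, 1} \<Longrightarrow> card {i. i \<le> k \<and> depth par i mod 2 = c} \<le> t"
    and X: "\<And>x. x \<in> X \<Longrightarrow> t \<le> card {y \<in> Y. (x, y) \<in> E}"
    and Y: "\<And>y. y \<in> Y \<Longrightarrow> t \<le> card {x \<in> X. (y, x) \<in> E}"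
  shows "hosts V E k par"
proof -
  define S where "S i = (if depth par i mod 2 = 0 then X else Y)" for i
  define A where "A i f = (if i = 0 then X else {z \<in> S i. (f (par i), z) \<in> E})" for i f
  have AS: "A i f \<subseteq> S i" for i f
    by (auto simp: A_def S_def depth.simps[of par 0])
  obtain f where f: "inj_on f {..k}" "\<And>i. i \<in> {..k} \<Longrightarrow> f i \<in> A i f"
  proof (rule sequential_choice[where I = "{..k}" and A = "\<lambda>i f. if i \<le> k then A i f else {}"])
    fix i and f g :: "nat \<Rightarrow> 'a" assume "\<And>j. j < i \<Longrightarrow> f j = g j"
    then show "(if i \<le> k then A i f else {}) = (if i \<le> k then A i g else {})"
      using par_less[of i] by (auto simp: A_def)
  next
    fix i f assume i: "i \<in> {..k}"
      and prev: "\<And>j. j < i \<Longrightarrow> j \<in> {..k} \<Longrightarrow> f j \<in> (if j \<le> k then A j f else {})"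
    show "\<exists>x\<in>if i \<le> k then A i f else {}. x \<notin> f ` {j \<in> {..k}. j < i}"
    proof (cases "i = 0")
      case True then show ?thesis using XY(5) by (auto simp: A_def)
    next
      case False
      let ?C = "{j. j \<le> k \<and> depth par j mod 2 = depth par i mod 2}"
      have ik: "i \<in> {1..k}" using i False by auto
      have "f (par i) \<in> S (par i)" using prev[of "par i"] AS par_less[OF ik] i by auto
      moreover have "S (par i) = X \<and> S i = Y \<or> S (par i) = Y \<and> S i = X"
        using depth_par[OF ik] by (auto simp: S_def mod_Suc)
      ultimately have "t \<le> card (A i f)" using X Y False by (auto simp: A_def)
      moreover have "f ` {j \<in> {..k}. j < i} \<inter> A i f \<subseteq> f ` (?C - {i})"
      proof
        fix x assume "x \<in> f ` {j \<in> {..k}. j < i} \<inter> A i f"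
        then obtain j where j: "j < i" "x = f j" "f j \<in> A i f" by auto
        then have "f j \<in> S j" "f j \<in> S i" using prev[of j] AS i by auto
        then have "depth par j mod 2 = depth par i mod 2"
          using XY(3) by (auto simp: S_def split: if_splits)
        with j i show "x \<in> f ` (?C - {i})" by auto
      qed
      then have "card (f ` {j \<in> {..k}. j < i} \<inter> A i f) \<le> card (f ` (?C - {i}))"
        by (intro card_mono) auto
      moreover have "card (f ` (?C - {i})) \<le> card (?C - {i})" by (rule card_image_le) simp
      moreover have "card (?C - {i}) < card ?C" using i by (intro psubset_card_mono) auto
      moreover have "depth par i mod 2 = 0 \<or> depth par i mod 2 = 1" by presburger
      then have "card ?C \<le> t" by (intro classes) simp
      ultimately have "card (f ` {j \<in> {..k}. j < i} \<inter> A i f) < card (A i f)" by linarith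
      then have "\<not> A i f \<subseteq> f ` {j \<in> {..k}. j < i}" by (metis inf.absorb2 less_irrefl)
      with i show ?thesis by auto
    qed
  qed auto
  have "f ` {..k} \<subseteq> V" using f(2) AS XY(4) by (fastforce simp: S_def split: if_splits)
  moreover have "(f (par i), f i) \<in> E" if "i \<in> {1..k}" for i
    using f(2)[of i] that by (auto simp: A_def)
  ultimately show ?thesis using f(1) unfolding hosts_def by blast
qed

text \<open>
  Here \<open>a\<close> and \<open>b\<close> are the sizes of the two parts and \<open>miss\<close> is the number of nonadjacent pairs
  between them. With the threshold \<open>m = k / (2\<Delta>)\<close>, at most \<open>miss / m\<close> vertices of the first part
  miss more than \<open>m\<close> vertices of the second one. After removal of these and of further \<open>m\<close>
  vertices, more than \<open>k - k / \<Delta>\<close> remain. With \<open>\<kappa> = (1 - 1 / (50 \<Delta>\<^sup>2)) (k - 1)\<close>, the bound is worst when both parts have the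
  maximal size \<open>c\<close>: the relevant expression is decreasing in \<open>b\<close> because \<open>a \<ge> \<kappa> / 2\<close>, and for \<open>b = c\<close>
  decreasing in \<open>a\<close> because \<open>m \<le> c - \<kappa> / 2\<close>.
\<close>

lemma bipartite_room:
  fixes a b k \<Delta> miss :: real
  assumes \<Delta>: "1 \<le> \<Delta>" and k: "8 * \<Delta>\<^sup>2 \<le> k"
    and a: "0 \<le> a" "a \<le> (1 + 1 / (25 * \<Delta>\<^sup>2)) * k"
    and b: "0 \<le> b" "b \<le> (1 + 1 / (25 * \<Delta>\<^sup>2)) * k"
    and miss: "0 \<le> miss" "miss < a * b - (1 - 1 / (50 * \<Delta>\<^sup>2)) * (k - 1) * (a + b) / 2"
  shows "k - k / \<Delta> < a - k / (2 * \<Delta>) - miss / (k / (2 * \<Delta>))"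
proof -
  define y where "y = k / \<Delta>\<^sup>2"
  define c where "c = (1 + 1 / (25 * \<Delta>\<^sup>2)) * k"
  define \<kappa> where "\<kappa> = (1 - 1 / (50 * \<Delta>\<^sup>2)) * (k - 1)"
  define m where "m = k / (2 * \<Delta>)"
  have \<Delta>2: "1 \<le> \<Delta>\<^sup>2" using \<Delta> by simp
  have ky: "k = y * \<Delta>\<^sup>2" using \<Delta> by (simp add: y_def)
  have y: "8 \<le> y" using k \<Delta> by (simp add: y_def field_simps)
  have my: "m = y * \<Delta> / 2" using \<Delta> by (simp add: m_def ky power2_eq_square)
  have cy: "c = k + y / 25" using \<Delta> by (simp add: c_def y_def field_simps)
  have "\<kappa> = k - 1 - y / 50 + 1 / (50 * \<Delta>\<^sup>2)" using \<Delta> by (simp add: \<kappa>_def y_def field_simps)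
  moreover have \<beta>: "0 \<le> 1 / (50 * \<Delta>\<^sup>2)" "1 / (50 * \<Delta>\<^sup>2) \<le> 1"
    using \<Delta>2 by (simp_all add: divide_le_eq_1)
  ultimately have \<kappa>: "c - \<kappa> \<le> 185 / 1000 * y" "\<kappa> \<le> k" using y cy by linarith+
  have k8: "8 \<le> k" using k \<Delta>2 by linarith
  have \<kappa>0: "0 \<le> \<kappa>" unfolding \<kappa>_def using \<beta> k8 by (intro mult_nonneg_nonneg) linarith+
  have m: "0 < m" "m \<le> k / 2" using \<Delta> k8 by (auto simp: m_def field_simps)
  have miss': "miss < a * b - \<kappa> * (a + b) / 2" using miss(2) by (simp add: \<kappa>_def)
  have "0 \<le> \<kappa> * a / 2" using \<kappa>0 a(1) by simp
  moreover have "b * (a - \<kappa> / 2) = (a * b - \<kappa> * (a + b) / 2) + \<kappa> * a / 2"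
    by (simp add: field_simps)
  ultimately have "0 < b * (a - \<kappa> / 2)" using miss' miss(1) by linarith
  then have a\<kappa>: "0 \<le> a - \<kappa> / 2" using b(1) by (simp add: zero_less_mult_iff)
  \<comment> \<open>monotonicity in \<open>b\<close>, and below in \<open>a\<close>, written as products of nonnegative factors\<close>
  have "0 \<le> (c - b) * (a - \<kappa> / 2)" using b(2) a\<kappa> by (intro mult_nonneg_nonneg) (auto simp: c_def)
  moreover have "(c - b) * (a - \<kappa> / 2) = (a * c - \<kappa> * (a + c) / 2) - (a * b - \<kappa> * (a + b) / 2)"
    by (simp add: field_simps)
  ultimately have 1: "miss < a * c - \<kappa> * (a + c) / 2" using miss' by linarith
  have "0 \<le> (c - a) * (c - \<kappa> / 2 - m)"
    using a(2) \<kappa>(2) m(2) y by (intro mult_nonneg_nonneg) (auto simp: c_def[symmetric] cy)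
  moreover have "(c - a) * (c - \<kappa> / 2 - m) =
      (m * a - a * c + \<kappa> * (a + c) / 2) - c * (m - (c - \<kappa>))"
    by (simp add: field_simps)
  ultimately have 2: "c * (m - (c - \<kappa>)) \<le> m * a - a * c + \<kappa> * (a + c) / 2" by linarith
  have "185 / 1000 * y \<le> m" using y \<Delta> by (simp add: my)
  then have "k * (m - 185 / 1000 * y) \<le> c * (m - (c - \<kappa>))"
    using \<kappa>(1) y k8 by (intro mult_mono) (auto simp: cy)
  \<comment> \<open>as \<open>1/2 - 1/4 - 185/1000 = 65/1000\<close>\<close>
  moreover have "k * (m - 185 / 1000 * y) - m * m - m * (k - k / \<Delta>) = 65 / 1000 * (y * \<Delta>)\<^sup>2"
    using \<Delta> by (simp add: my ky power2_eq_square field_simps)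
  moreover have "(a - m) * m = m * a - m * m" by (simp add: algebra_simps)
  ultimately have "m * (k - k / \<Delta>) < (a - m) * m - miss"
    using 1 2 zero_le_power2[of "y * \<Delta>"] by linarith
  then show ?thesis unfolding m_def[symmetric] using m(1) by (simp add: field_simps)
qed

text \<open>
  The hypothesis \<open>cross\<close> bounds the number of edges between \<open>A\<close> and \<open>B\<close> from below by what the
  average degree and the \<open>\<beta>\<close>-bipartiteness guarantee. The sets \<open>X\<close> and \<open>Y\<close> of the good vertices of
  the two parts then satisfy the degree conditions of the bipartite greedy embedding.
\<close>

lemma (in parent_tree) hosts_almost_bipartite:
  fixes V :: "'a set" and \<Delta> :: nat
  assumes \<Delta>: "1 \<le> \<Delta>" and k: "8 * \<Delta>\<^sup>2 \<le> k"
    and deg: "\<And>i. i \<le> k \<Longrightarrow> card (children k par i) + (if i = 0 then 0 else 1) \<le> \<Delta>"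
    and V: "finite A" "finite B" "A \<inter> B = {}" "A \<union> B \<subseteq> V"
    and sym: "\<And>x y. (x, y) \<in> E \<Longrightarrow> (y, x) \<in> E"
    and A: "real (card A) \<le> (1 + 1 / (25 * (real \<Delta>)\<^sup>2)) * k"
    and B: "real (card B) \<le> (1 + 1 / (25 * (real \<Delta>)\<^sup>2)) * k"
    and cross: "(1 - 1 / (50 * (real \<Delta>)\<^sup>2)) * (real k - 1) * (real (card A) + real (card B)) / 2
      < real (card (E \<inter> A \<times> B))"
  shows "hosts V E k par"
proof -
  define m where "m = real k / (2 * real \<Delta>)"
  have k0: "0 < k" using \<Delta> k by (auto intro: gr0I)
  have m: "0 < m" using \<Delta> k0 by (simp add: m_def)
  have many: "real k - real k / real \<Delta> < real (card {x \<in> X. real (card {y \<in> Y. (x, y) \<notin> E}) \<le> m}) - m"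
    if X: "finite X" "real (card X) \<le> (1 + 1 / (25 * (real \<Delta>)\<^sup>2)) * k"
      and Y: "finite Y" "real (card Y) \<le> (1 + 1 / (25 * (real \<Delta>)\<^sup>2)) * k"
      and XY: "(1 - 1 / (50 * (real \<Delta>)\<^sup>2)) * (real k - 1) * (real (card X) + real (card Y)) / 2
        < real (card (E \<inter> X \<times> Y))" for X Y
  proof -
    let ?n = "\<lambda>x. {y \<in> Y. (x, y) \<notin> E}"
    let ?G = "{x \<in> X. real (card (?n x)) \<le> m}"
    define miss where "miss = card (X \<times> Y - E)"
    have "card (X \<times> Y) = card (E \<inter> X \<times> Y) + miss"
      unfolding miss_def using X(1) Y(1) card_Int_Diff[of "X \<times> Y" E] by (simp add: Int_commute)
    then have prod: "real (card X) * real (card Y) = real (card (E \<inter> X \<times> Y)) + real miss"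
      by (simp add: card_cartesian_product flip: of_nat_mult of_nat_add)
    have room: "real k - real k / real \<Delta> < real (card X) - m - real miss / m"
      unfolding m_def
    proof (rule bipartite_room)
      show "8 * (real \<Delta>)\<^sup>2 \<le> real k"
        using k by (metis of_nat_le_iff of_nat_mult of_nat_numeral of_nat_power)
      show "real miss < real (card X) * real (card Y) -
          (1 - 1 / (50 * (real \<Delta>)\<^sup>2)) * (real k - 1) * (real (card X) + real (card Y)) / 2"
        using XY prod by linarith
    qed (use \<Delta> X(2) Y(2) in simp_all)
    have "X \<times> Y - E = Sigma X ?n" by auto
    then have "miss = (\<Sum>x\<in>X. card (?n x))" unfolding miss_def using X(1) Y(1) by simp
    then have miss: "real miss = (\<Sum>x\<in>X. real (card (?n x)))" by simp
    have "real (card (X - ?G)) * m = (\<Sum>x\<in>X - ?G. m)" by simp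
    also have "\<dots> \<le> (\<Sum>x\<in>X - ?G. real (card (?n x)))" by (intro sum_mono) auto
    also have "\<dots> \<le> real miss" unfolding miss using X(1) by (intro sum_mono2) auto
    finally have "real (card (X - ?G)) * m \<le> real miss" .
    then have "real (card (X - ?G)) \<le> real miss / m" using m by (simp add: field_simps)
    moreover have "X \<inter> ?G = ?G" by auto
    then have "card X = card ?G + card (X - ?G)" using card_Int_Diff[OF X(1), of ?G] by simp
    ultimately show ?thesis using room by simp
  qed
  define X where "X = {x \<in> A. real (card {y \<in> B. (x, y) \<notin> E}) \<le> m}"
  define Y where "Y = {y \<in> B. real (card {x \<in> A. (y, x) \<notin> E}) \<le> m}"
  have X: "real k - real k / real \<Delta> < real (card X) - m"
    unfolding X_def by (rule many[OF V(1) A V(2) B cross])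
  have "card (E \<inter> B \<times> A) = card (E \<inter> A \<times> B)"
    using sym by (intro bij_betw_same_card[of prod.swap] bij_betwI[of _ _ _ prod.swap]) auto
  then have Y: "real k - real k / real \<Delta> < real (card Y) - m"
    unfolding Y_def using cross by (intro many V A B) (simp add: add.commute)
  define cl where "cl c = card {i. i \<le> k \<and> depth par i mod 2 = c}" for c
  define t where "t = max (cl 0) (cl 1)"
  have "depth par i mod 2 = 0 \<or> depth par i mod 2 = 1" for i by presburger
  then have "{..k} = {i. i \<le> k \<and> depth par i mod 2 = 0} \<union> {i. i \<le> k \<and> depth par i mod 2 = 1}"
    by blast
  then have "card {..k} = card ({i. i \<le> k \<and> depth par i mod 2 = 0} \<union> {i. i \<le> k \<and> depth par i mod 2 = 1})"
    by (rule arg_cong)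
  also have "\<dots> = cl 0 + cl 1" unfolding cl_def by (rule card_Un_disjoint) auto
  finally have "cl 0 + cl 1 = k + 1" by simp
  moreover have "real k \<le> real \<Delta> * real (cl c)" if "c \<in> {0, 1}" for c
    using colour_class_ge[OF deg that] unfolding cl_def by (simp flip: of_nat_mult)
  then have "real k / real \<Delta> \<le> real (cl c)" if "c \<in> {0, 1}" for c
    using that \<Delta> by (simp add: field_simps)
  ultimately have t: "real t \<le> real k + 1 - real k / real \<Delta>"
    unfolding t_def by (fastforce simp: max_def)
  have deg_ge: "t \<le> card {y \<in> Q. (x, y) \<in> E}"
    if "finite P" "Q \<subseteq> P" "real (card {y \<in> P. (x, y) \<notin> E}) \<le> m" "real k - real k / real \<Delta> < real (card Q) - m"
    for P Q x
  proof -
    have "card Q \<le> card ({y \<in> Q. (x, y) \<in> E} \<union> {y \<in> P. (x, y) \<notin> E})"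
      using that(1,2) by (intro card_mono) (auto intro: finite_subset)
    also have "\<dots> \<le> card {y \<in> Q. (x, y) \<in> E} + card {y \<in> P. (x, y) \<notin> E}" by (rule card_Un_le)
    finally have "real (card Q) \<le> real (card {y \<in> Q. (x, y) \<in> E}) + real (card {y \<in> P. (x, y) \<notin> E})"
      by linarith
    with that(3,4) t have "real t < real (card {y \<in> Q. (x, y) \<in> E}) + 1" by linarith
    then show ?thesis by linarith
  qed
  have "real k / real \<Delta> \<le> real k" using \<Delta> divide_left_mono[of 1 "real \<Delta>" "real k"] by simp
  then have "X \<noteq> {}" using X m by auto
  then show ?thesis
  proof (rule bipartite_greedy[where Y = Y and t = t, rotated 4])
    show "card {i. i \<le> k \<and> depth par i mod 2 = c} \<le> t" if "c \<in> {0, 1}" for c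
      using that by (auto simp: t_def cl_def)
    show "t \<le> card {y \<in> Y. (x, y) \<in> E}" if "x \<in> X" for x
      using that Y V(2) by (intro deg_ge[of B]) (auto simp: X_def Y_def)
    show "t \<le> card {x \<in> X. (y, x) \<in> E}" if "y \<in> Y" for y
      using that X V(1) by (intro deg_ge[of A]) (auto simp: X_def Y_def)
    have "X \<subseteq> A" "Y \<subseteq> B" by (auto simp: X_def Y_def)
    then show "finite X" "finite Y" "X \<inter> Y = {}" "X \<union> Y \<subseteq> V"
      using V finite_subset by blast+
  qed
qed

section \<open>Completing a placement in an almost complete host\<close>

lemma exists_outside:
  assumes "finite N" "finite Q" "card N + card Q < card C"
  shows "\<exists>x\<in>C - N. x \<notin> Q"
proof (rule ccontr)
  assume "\<not> ?thesis"
  then have "C \<subseteq> N \<union> Q" by auto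
  then have "card C \<le> card (N \<union> Q)" using assms(1,2) by (intro card_mono) auto
  with card_Un_le[of N Q] assms(3) show False by linarith
qed

text \<open>Markov's inequality for counting.\<close>

lemma card_filter_mult_le_sum:
  fixes w :: "'b \<Rightarrow> nat"
  assumes "finite X"
  shows "card {x \<in> X. t \<le> w x} * t \<le> sum w X"
proof -
  have "card {x \<in> X. t \<le> w x} * t \<le> sum w {x \<in> X. t \<le> w x}"
    using sum_bounded_below[of "{x \<in> X. t \<le> w x}" t w] by simp
  also have "\<dots> \<le> sum w X" using assms by (intro sum_mono2) auto
  finally show ?thesis .
qed

locale host_graph =
  fixes V :: "'a set" and E :: "'a rel"
  assumes finite_V: "finite V"
    and sym_E: "(x, y) \<in> E \<Longrightarrow> (y, x) \<in> E"
begin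

definition nonnbrs :: "'a \<Rightarrow> 'a set" where
  "nonnbrs v = {w \<in> V. w \<noteq> v \<and> (v, w) \<notin> E}"

lemma finite_nonnbrs [simp]: "finite (nonnbrs v)" using finite_V by (simp add: nonnbrs_def)

lemma nonnbrs_sym: "w \<in> V \<Longrightarrow> v \<in> V \<Longrightarrow> w \<in> nonnbrs v \<longleftrightarrow> v \<in> nonnbrs w"
  using sym_E by (auto simp: nonnbrs_def)

end

text \<open>
  The surplus \<open>D\<close> is the number of vertices of the host minus the number of edges of the tree; as the
  tree has \<open>k + 1\<close> vertices, \<open>D - 1\<close> vertices of the host stay unused.
\<close>

locale tree_in_host = parent_tree k par + host_graph V E
  for k :: nat and par :: "nat \<Rightarrow> nat" and V :: "'a set" and E :: "'a rel" +
  fixes D :: nat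
  assumes card_V: "card V = k + D" and D_pos: "1 \<le> D"
begin

text \<open>
  Hall's theorem for placing an independent set \<open>M\<close> of tree vertices at the end. If it fails for
  \<open>S \<subseteq> M\<close>, the obstruction \<open>Z\<close> is the set of the free vertices on which no vertex of \<open>S\<close> can be
  placed. Since there are \<open>|M| + D - 1\<close> free vertices, \<open>|S| + |Z| \<ge> |M| + D\<close>.
\<close>

lemma complete_placement:
  assumes M: "M \<subseteq> {1..k}" and indep: "\<And>i. i \<in> M \<Longrightarrow> par i \<notin> M"
    and inj: "inj_on f ({..k} - M)" and fV: "f ` ({..k} - M) \<subseteq> V"
    and adj: "\<And>i. i \<in> {1..k} - M \<Longrightarrow> par i \<notin> M \<Longrightarrow> (f (par i), f i) \<in> E"
    and no_obstruction: "\<And>S Z. S \<subseteq> M \<Longrightarrow> S \<noteq> {} \<Longrightarrow> Z \<subseteq> V - f ` ({..k} - M) \<Longrightarrow> D \<le> card Z \<Longrightarrow>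
      card M + D \<le> card S + card Z \<Longrightarrow>
      (\<And>m z. m \<in> S \<Longrightarrow> z \<in> Z \<Longrightarrow> z \<in> nonnbrs (f (par m)) \<or> (\<exists>j\<in>children k par m. z \<in> nonnbrs (f j))) \<Longrightarrow> False"
  shows "hosts V E k par"
proof -
  let ?I = "{..k} - M"
  let ?R = "V - f ` ?I"
  define N where "N m = {z \<in> ?R. z \<notin> nonnbrs (f (par m)) \<and> (\<forall>j\<in>children k par m. z \<notin> nonnbrs (f j))}" for m
  have finM: "finite M" using M finite_subset by blast
  have finR: "finite ?R" using finite_V by simp
  have "card ?I = k + 1 - card M" using M by (subst card_Diff_subset[OF finM]) auto
  moreover have "card M \<le> k" using card_mono[OF _ M] by simp
  moreover have "card ?R = card V - card ?I"
    using fV inj by (subst card_Diff_subset) (auto simp: card_image)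
  ultimately have cR: "card ?R + 1 = card M + D" using card_V D_pos by simp
  obtain g where g: "inj_on g M" "\<And>m. m \<in> M \<Longrightarrow> g m \<in> N m"
  proof (rule hall_marriage[OF finM, of N])
    show "finite (N i)" for i using finR by (simp add: N_def)
  next
    fix S assume S: "S \<subseteq> M"
    show "card S \<le> card (\<Union>m\<in>S. N m)"
    proof (rule ccontr)
      assume less: "\<not> ?thesis"
      define Z where "Z = ?R - (\<Union>m\<in>S. N m)"
      have sub: "(\<Union>m\<in>S. N m) \<subseteq> ?R" by (auto simp: N_def)
      then have "card Z = card ?R - card (\<Union>m\<in>S. N m)"
        unfolding Z_def using finR by (intro card_Diff_subset) (auto intro: finite_subset)
      moreover have "card (\<Union>m\<in>S. N m) \<le> card ?R" using sub finR by (rule card_mono[rotated])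
      ultimately have big: "card M + D \<le> card S + card Z" using cR less by linarith
      have "card S \<le> card M" using S finM by (rule card_mono[rotated])
      with big have "D \<le> card Z" by linarith
      moreover have "S \<noteq> {}" using less by auto
      moreover have "z \<in> nonnbrs (f (par m)) \<or> (\<exists>j\<in>children k par m. z \<in> nonnbrs (f j))"
        if "m \<in> S" "z \<in> Z" for m z using that by (auto simp: Z_def N_def)
      ultimately show False using S big by (intro no_obstruction[of S Z]) (auto simp: Z_def)
    qed
  qed auto
  define F where "F i = (if i \<in> M then g i else f i)" for i
  have "inj_on F (M \<union> ?I)" unfolding F_def
    using g inj by (intro inj_on_disjoint_Un) (auto simp: N_def)
  moreover have "M \<union> ?I = {..k}" using M by auto
  moreover have "F ` {..k} \<subseteq> V" using g(2) fV by (auto simp: F_def N_def)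
  moreover have "(F (par i), F i) \<in> E" if i: "i \<in> {1..k}" for i
  proof -
    have pi: "par i \<le> k" using par_less[OF i] i by auto
    consider "i \<in> M" "par i \<notin> M" | "i \<notin> M" "par i \<in> M" | "i \<notin> M" "par i \<notin> M"
      using indep by blast
    then show ?thesis
    proof cases
      case 1
      then have "g i \<in> ?R" "g i \<notin> nonnbrs (f (par i))" using g(2)[of i] by (auto simp: N_def)
      moreover from this have "g i \<noteq> f (par i)" using 1 pi by auto
      ultimately show ?thesis using 1 by (auto simp: F_def nonnbrs_def)
    next
      case 2
      have "i \<in> children k par (par i)" using i by (simp add: children_def)
      with 2 have "g (par i) \<in> ?R" "g (par i) \<notin> nonnbrs (f i)"
        using g(2)[of "par i"] by (auto simp: N_def)
      moreover from this have "g (par i) \<noteq> f i" using 2 i by auto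
      ultimately show ?thesis using 2 by (auto simp: F_def nonnbrs_def intro: sym_E)
    next
      case 3 then show ?thesis using adj[of i] i by (simp add: F_def)
    qed
  qed
  ultimately show ?thesis unfolding hosts_def by (intro exI[of _ F]) auto
qed

definition leaves :: "nat set" where
  "leaves = {i. i \<le> k \<and> children k par i = {}}"

text \<open>
  A leaf whose parent sits on a low vertex can be placed on all but at most \<open>D - 1\<close> of the free
  vertices, so it never belongs to an obstruction.
\<close>

definition low :: "'a set" where
  "low = {v \<in> V. card (nonnbrs v) < D}"

end

text \<open>
  The unit \<open>h\<close> for all error terms is \<open>k div 10000\<close>. The hypothesis \<open>few_nonedges\<close> is the one on the
  average degree, stated for the complement.
\<close>

locale tree_in_dense_host = tree_in_host k par V E D
  for k :: nat and par :: "nat \<Rightarrow> nat" and V :: "'a set" and E :: "'a rel" and D :: nat +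
  fixes h :: nat
  assumes few_nonedges: "(\<Sum>v\<in>V. card (nonnbrs v)) < D * card V"
    and h: "10000 * h \<le> k" "k < 10000 * h + 10000"
    and D_small: "10000000 * D \<le> h"
begin

definition good :: "'a set" where
  "good = {v \<in> V. card (nonnbrs v) \<le> h}"

lemma h_pos: "10000000 \<le> h" using D_small D_pos by linarith

lemma card_not_good: "card (V - good) \<le> h"
proof (rule ccontr)
  assume "\<not> ?thesis"
  then have "(h + 1) * (h + 1) \<le> card (V - good) * (h + 1)" by (intro mult_le_mono1) simp
  also have "V - good = {v \<in> V. h + 1 \<le> card (nonnbrs v)}" by (auto simp: good_def)
  also have "card \<dots> * (h + 1) \<le> (\<Sum>v\<in>V. card (nonnbrs v))" by (rule card_filter_mult_le_sum[OF finite_V])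
  also have "\<dots> < D * (k + D)" using few_nonedges card_V by simp
  also have "\<dots> \<le> D * (10001 * (h + 1))"
    using h D_small by (intro mult_le_mono2) simp
  finally have "(h + 1) * (h + 1) < 10001 * D * (h + 1)" by (simp only: ac_simps)
  then have "h + 1 < 10001 * D" using mult_less_cancel2 by blast
  with D_small show False by linarith
qed

lemma card_good: "k + D \<le> card good + h"
proof -
  have "card V = card good + card (V - good)"
    using finite_V by (subst card_Un_disjoint[symmetric]) (auto simp: good_def intro: arg_cong[of _ _ card])
  with card_not_good card_V show ?thesis by linarith
qed

lemma low_good: "low \<subseteq> good" using D_small by (auto simp: low_def good_def)

lemma leaves_subset: "leaves \<subseteq> {1..k}"
proof -
  have "1 \<in> children k par 0" using h h_pos par_less[of 1] by (auto simp: children_def)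
  then show ?thesis by (auto simp: leaves_def Suc_le_eq intro!: gr0I)
qed

lemma finite_leaves: "finite leaves" using leaves_subset finite_subset by blast

lemma par_not_leaf: "i \<in> {1..k} \<Longrightarrow> par i \<in> {..k} - leaves"
  using par_less[of i] by (auto simp: leaves_def children_def)

lemma card_nonleaves: "card ({..k} - leaves) + card leaves = k + 1"
proof -
  have "leaves \<subseteq> {..k}" by (auto simp: leaves_def)
  then show ?thesis
    using card_Diff_subset[OF finite_leaves] card_mono[OF finite_atMost] by simp
qed

definition blocked :: "(nat \<Rightarrow> 'a) \<Rightarrow> nat \<Rightarrow> 'a set" where
  "blocked f i = (if i = 0 then {} else nonnbrs (f (par i)))"

text \<open>
  A placement of the nonleaves extends to the leaves unless nearly all leaves have parents whose
  images share a set \<open>Z\<close> of \<open>D\<close> nonneighbours.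
\<close>

lemma complete_leaves:
  assumes inj: "inj_on f ({..k} - leaves)"
    and fV: "\<And>i. i \<in> {..k} - leaves \<Longrightarrow> f i \<in> V"
    and adj: "\<And>i. i \<in> {..k} - leaves \<Longrightarrow> f i \<notin> blocked f i"
    and no_obstruction: "\<And>S Z. S \<subseteq> leaves \<Longrightarrow> S \<noteq> {} \<Longrightarrow> Z \<subseteq> V \<Longrightarrow> D \<le> card Z \<Longrightarrow>
      card leaves + D \<le> card S + card Z \<Longrightarrow>
      (\<And>l. l \<in> S \<Longrightarrow> Z \<subseteq> nonnbrs (f (par l))) \<Longrightarrow> False"
  shows "hosts V E k par"
proof (rule complete_placement[of leaves f])
  show "leaves \<subseteq> {1..k}" by (rule leaves_subset)
  show "par i \<notin> leaves" if "i \<in> leaves" for i using par_not_leaf leaves_subset that by blast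
  show "inj_on f ({..k} - leaves)" by (rule inj)
  show "f ` ({..k} - leaves) \<subseteq> V" using fV by auto
  show "(f (par i), f i) \<in> E" if i: "i \<in> {1..k} - leaves" for i
  proof -
    have "par i \<in> {..k} - leaves" using par_not_leaf i by auto
    moreover have "par i \<noteq> i" using par_less[of i] i by auto
    ultimately have "f i \<noteq> f (par i)" using inj i by (auto dest: inj_onD)
    with adj[of i] fV[of i] i show ?thesis by (auto simp: blocked_def nonnbrs_def)
  qed
  show False if "S \<subseteq> leaves" "S \<noteq> {}" "Z \<subseteq> V - f ` ({..k} - leaves)" "D \<le> card Z"
    "card leaves + D \<le> card S + card Z"
    "\<And>m z. m \<in> S \<Longrightarrow> z \<in> Z \<Longrightarrow> z \<in> nonnbrs (f (par m)) \<or> (\<exists>j\<in>children k par m. z \<in> nonnbrs (f j))" for S Z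
  proof (rule no_obstruction[of S Z])
    fix l assume "l \<in> S"
    then show "Z \<subseteq> nonnbrs (f (par l))" using that(1) that(6)[of l] by (auto simp: leaves_def)
  qed (use that in auto)
qed

subsection \<open>Trees with many leaves\<close>

text \<open>
  The images are restricted to candidate sets \<open>C i f\<close> of vertices with at most \<open>b\<close> nonneighbours, so
  the image of the parent blocks at most \<open>b\<close> candidates.
\<close>

lemma greedy_nonleaves:
  fixes C :: "nat \<Rightarrow> (nat \<Rightarrow> 'a) \<Rightarrow> 'a set"
  defines "I \<equiv> {..k} - leaves"
  assumes local: "\<And>i f g. (\<And>j. j < i \<Longrightarrow> f j = g j) \<Longrightarrow> C i f = C i g"
    and small: "\<And>i f v. v \<in> C i f \<Longrightarrow> card (nonnbrs v) \<le> b"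
    and room: "\<And>i f. i \<in> I \<Longrightarrow> (\<And>j. j < i \<Longrightarrow> j \<in> I \<Longrightarrow> f j \<in> C j f) \<Longrightarrow>
      b + card (f ` {j \<in> I. j < i} \<inter> C i f) < card (C i f)"
  obtains f where "inj_on f I" "\<And>i. i \<in> I \<Longrightarrow> f i \<in> C i f" "\<And>i. i \<in> I \<Longrightarrow> f i \<notin> blocked f i"
proof -
  let ?A = "\<lambda>i f. if i \<in> I then C i f - blocked f i else {}"
  obtain f where f: "inj_on f I" "\<And>i. i \<in> I \<Longrightarrow> f i \<in> ?A i f"
  proof (rule sequential_choice[where I = I and A = ?A])
    fix i and f g :: "nat \<Rightarrow> 'a" assume "\<And>j. j < i \<Longrightarrow> f j = g j"
    then show "?A i f = ?A i g"
      using par_less[of i] local[of i f g] by (auto simp: blocked_def I_def)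
  next
    fix i f assume i: "i \<in> I" and prev: "\<And>j. j < i \<Longrightarrow> j \<in> I \<Longrightarrow> f j \<in> ?A j f"
    have "card (blocked f i) \<le> b"
    proof (cases "i = 0")
      case False
      then have "par i < i" "par i \<in> I" using i par_less[of i] par_not_leaf[of i] by (auto simp: I_def)
      then show ?thesis using prev[of "par i"] small False by (auto simp: blocked_def)
    qed (simp add: blocked_def)
    moreover have "b + card (f ` {j \<in> I. j < i} \<inter> C i f) < card (C i f)"
      using prev by (intro room i) (auto split: if_splits)
    ultimately have "\<exists>x\<in>C i f - blocked f i. x \<notin> f ` {j \<in> I. j < i} \<inter> C i f"
      by (intro exists_outside) (auto simp: blocked_def I_def)
    then show "\<exists>x\<in>?A i f. x \<notin> f ` {j \<in> I. j < i}"
      using i by auto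
  qed auto
  then show thesis using that[of f] by (meson DiffD1 DiffD2)
qed

text \<open>
  All nonleaves go to good vertices, so an obstruction has \<open>|Z| \<le> h\<close> and \<open>S\<close> misses fewer than \<open>h\<close>
  leaves. Reserving \<open>10 h\<close> low vertices for the parents of a set \<open>L'\<close> of \<open>h + 1\<close> leaves makes sure
  that the parent of some leaf in \<open>S\<close> is on a low vertex.
\<close>

lemma hosts_many_leaves_many_low:
  assumes L: "100 * h \<le> card leaves" and U: "10 * h \<le> card low"
  shows "hosts V E k par"
proof -
  obtain U' where U': "U' \<subseteq> low" "card U' = 10 * h" using U by (meson obtain_subset_with_card_n)
  obtain L' where L': "L' \<subseteq> leaves" "card L' = h + 1"
    using obtain_subset_with_card_n[of "h + 1" leaves] L h_pos by auto
  have fin: "finite U'" "finite L'" "finite good"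
    using U'(1) L'(1) finite_V finite_leaves by (auto simp: low_def good_def intro: finite_subset)
  define P where "P = par ` L'"
  define C where "C i = (if i \<in> P then U' else good - U')" for i
  have C_good: "C i \<subseteq> good" for i using U'(1) low_good by (auto simp: C_def)
  define I where "I = {..k} - leaves"
  have parI: "par i \<in> I" if "i \<in> {1..k}" for i using par_not_leaf that by (simp add: I_def)
  obtain f where f: "inj_on f I" and fC: "\<And>i. i \<in> I \<Longrightarrow> f i \<in> C i"
    "\<And>i. i \<in> I \<Longrightarrow> f i \<notin> blocked f i"
  proof (rule greedy_nonleaves[of "\<lambda>i f. C i" h, folded I_def])
    fix i and f :: "nat \<Rightarrow> 'a"
    assume i: "i \<in> I" and prev: "\<And>j. j < i \<Longrightarrow> j \<in> I \<Longrightarrow> f j \<in> C j"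
    let ?Q = "f ` {j \<in> I. j < i} \<inter> C i"
    show "h + card ?Q < card (C i)"
    proof (cases "i \<in> P")
      case True
      have "?Q \<subseteq> f ` P" using prev True by (fastforce simp: C_def split: if_splits)
      then have "card ?Q \<le> card P" using fin(2) by (intro surj_card_le) (auto simp: P_def)
      also have "\<dots> \<le> h + 1" using L'(2) fin(2) card_image_le[of L' par] by (simp add: P_def)
      finally show ?thesis using True U'(2) h_pos by (simp add: C_def)
    next
      case False
      have "card ?Q \<le> card I" by (intro surj_card_le[of _ _ f]) (auto simp: I_def)
      moreover have "card (good - U') = card good - 10 * h"
        using U' low_good fin(1) by (subst card_Diff_subset) auto
      ultimately show ?thesis
        using card_good card_nonleaves L h_pos False by (simp add: C_def I_def)
    qed
  qed (use C_good in \<open>auto simp: good_def\<close>)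
  show ?thesis
  proof (rule complete_leaves[of f])
    fix S Z assume SZ: "S \<subseteq> leaves" "S \<noteq> {}" "Z \<subseteq> V" "D \<le> card Z"
      "card leaves + D \<le> card S + card Z" "\<And>l. l \<in> S \<Longrightarrow> Z \<subseteq> nonnbrs (f (par l))"
    have Zle: "card Z \<le> card (nonnbrs (f (par l)))" if "l \<in> S" for l
      using SZ(6)[OF that] by (intro card_mono) auto
    have img: "f (par l) \<in> C (par l)" if "l \<in> S" for l
      using that SZ(1) leaves_subset by (intro fC parI) auto
    obtain l where "l \<in> S" using SZ(2) by auto
    then have "card Z \<le> h" using Zle[of l] img[of l] C_good by (force simp: good_def)
    then have big: "card leaves < card S + card L'" using SZ(5) L'(2) D_pos by linarith
    have "S \<inter> L' \<noteq> {}"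
    proof
      assume "S \<inter> L' = {}"
      then have "card S + card L' = card (S \<union> L')"
        using SZ(1) fin(2) finite_leaves by (subst card_Un_disjoint) (auto intro: finite_subset)
      also have "\<dots> \<le> card leaves" using SZ(1) L'(1) finite_leaves by (intro card_mono) auto
      finally show False using big by simp
    qed
    then obtain l where l: "l \<in> S" "l \<in> L'" by auto
    then have "f (par l) \<in> low" using img[of l] U'(1) by (auto simp: C_def P_def)
    with Zle[OF l(1)] SZ(4) show False by (auto simp: low_def)
  qed (use f fC C_good in \<open>auto simp: I_def good_def\<close>)
qed

text \<open>
  Let \<open>t\<close> be minimal such that at least \<open>3 D\<close> leaves have their parent among the tree
  vertices \<open>0, \<dots>, t - 1\<close>. All nonleaves go to the set \<open>W\<close> of vertices with at most \<open>2 D\<close>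
  nonneighbours, so an obstruction has \<open>|Z| \<le> 2 D\<close> and \<open>S\<close> misses at most \<open>D\<close> leaves. Thus each
  \<open>z \<in> Z\<close> is nonadjacent to the parents of all but \<open>D\<close> of the early leaves, that is, \<open>Z\<close> lies in the
  set \<open>R f\<close> below, and \<open>|R f| \<le> 3 D\<close> by double counting. As nearly all vertices have about \<open>D\<close>
  nonneighbours, double counting again shows that few vertices have \<open>D\<close> nonneighbours in \<open>R f\<close>. Tree
  vertices from \<open>t\<close> on avoid these, so no set \<open>Z \<subseteq> R f\<close> of size \<open>D\<close> consists of nonneighbours of such
  a parent; but \<open>S\<close> contains a leaf with such a parent.
\<close>

lemma hosts_many_leaves_few_low:
  assumes L: "100 * h \<le> card leaves" and U: "card low < 10 * h"
    and children_le: "\<And>i. i \<le> k \<Longrightarrow> card (children k par i) \<le> h"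
  shows "hosts V E k par"
proof -
  define I where "I = {..k} - leaves"
  have parI: "par i \<in> I" if "i \<in> leaves" for i
    using par_not_leaf leaves_subset that by (auto simp: I_def)
  \<comment> \<open>vertices that are not low contribute at least \<open>D\<close> each to a sum below \<open>D |V|\<close>\<close>
  have excess: "(\<Sum>v\<in>V. card (nonnbrs v) - D) < D * (10 * h)"
  proof -
    have le: "(\<Sum>v\<in>V. card (nonnbrs v) - D) \<le> (\<Sum>v\<in>V. card (nonnbrs v))" by (intro sum_mono) simp
    have "D * card V \<le> (\<Sum>v\<in>V. card (nonnbrs v) - (card (nonnbrs v) - D) + (if v \<in> low then D else 0))"
      using sum_bounded_below[of V D "\<lambda>v. card (nonnbrs v) - (card (nonnbrs v) - D) + (if v \<in> low then D else 0)"]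
      by (auto simp: low_def mult.commute)
    also have "\<dots> = (\<Sum>v\<in>V. card (nonnbrs v)) - (\<Sum>v\<in>V. card (nonnbrs v) - D) + D * card low"
    proof -
      have "(\<Sum>v\<in>V. if v \<in> low then D else 0) = (\<Sum>v\<in>low. D)"
        using finite_V by (intro sum.mono_neutral_cong_right) (auto simp: low_def)
      moreover have "(\<Sum>v\<in>V. card (nonnbrs v) - (card (nonnbrs v) - D)) =
          (\<Sum>v\<in>V. card (nonnbrs v)) - (\<Sum>v\<in>V. card (nonnbrs v) - D)"
        by (rule sum_subtractf_nat) simp
      ultimately show ?thesis by (simp only: sum.distrib sum_constant of_nat_id mult.commute)
    qed
    finally have "(\<Sum>v\<in>V. card (nonnbrs v) - D) < D * card low" using few_nonedges le by linarith
    also have "\<dots> \<le> D * (10 * h)" using U by simp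
    finally show ?thesis .
  qed
  define W where "W = {v \<in> V. card (nonnbrs v) \<le> 2 * D}"
  have W: "card (V - W) \<le> 10 * h"
  proof -
    have "card (V - W) * D \<le> card {v \<in> V. D \<le> card (nonnbrs v) - D} * D"
      using finite_V by (intro mult_le_mono1 card_mono) (auto simp: W_def)
    also have "\<dots> \<le> (\<Sum>v\<in>V. card (nonnbrs v) - D)" by (rule card_filter_mult_le_sum[OF finite_V])
    also have "\<dots> < 10 * h * D" using excess by (simp add: ac_simps)
    finally show ?thesis by simp
  qed
  define early where "early t = {l \<in> leaves. par l < t}" for t
  define t where "t = (LEAST t. 3 * D \<le> card (early t))"
  have "early (Suc k) = leaves" using leaves_subset par_less by (fastforce simp: early_def)
  then have "3 * D \<le> card (early (Suc k))" using L D_small by simp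
  then have t: "3 * D \<le> card (early t)" unfolding t_def by (rule LeastI)
  have early_fin: "finite (early s)" for s using finite_leaves by (simp add: early_def)
  have t_max: "card (early t) < 3 * D + h"
  proof -
    have "t \<noteq> 0" using t D_pos by (auto simp: early_def intro: ccontr)
    then have "card (early (t - 1)) < 3 * D"
      using not_less_Least[of "t - 1" "\<lambda>t. 3 * D \<le> card (early t)"] by (simp add: t_def)
    moreover have "early t \<subseteq> early (t - 1) \<union> children k par (t - 1)"
      using leaves_subset by (auto simp: early_def children_def)
    then have "card (early t) \<le> card (early (t - 1) \<union> children k par (t - 1))"
      using early_fin by (intro card_mono) auto
    moreover have "card (children k par (t - 1)) \<le> h"
    proof (cases "t - 1 \<le> k")
      case False
      then have "children k par (t - 1) = {}" using par_less by (fastforce simp: children_def)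
      then show ?thesis by simp
    qed (rule children_le)
    ultimately show ?thesis using card_Un_le[of "early (t - 1)" "children k par (t - 1)"] by linarith
  qed
  let ?L = "early t"
  \<comment> \<open>both sets depend on \<open>f\<close> only through its values below \<open>t\<close>\<close>
  define R where "R f = {r \<in> V. card ?L - D \<le> card {l \<in> ?L. r \<in> nonnbrs (f (par l))}}" for f :: "nat \<Rightarrow> 'a"
  define Bad where "Bad f = {v \<in> V. D \<le> card (nonnbrs v \<inter> R f)}" for f
  define C where "C i f = (if i < t then W else W - Bad f)" for i f
  have CW: "C i f \<subseteq> W" for i f by (auto simp: C_def)
  have R_small: "card (R f) \<le> 3 * D" if fW: "\<And>j. j < t \<Longrightarrow> j \<in> I \<Longrightarrow> f j \<in> W" for f
  proof (rule ccontr)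
    assume "\<not> ?thesis"
    then have "(3 * D + 1) * (card ?L - D) \<le> card (R f) * (card ?L - D)" by (intro mult_le_mono1) simp
    also have "\<dots> \<le> (\<Sum>r\<in>V. card {l \<in> ?L. r \<in> nonnbrs (f (par l))})"
      unfolding R_def by (rule card_filter_mult_le_sum[OF finite_V])
    also have "\<dots> = (\<Sum>l\<in>?L. card (nonnbrs (f (par l))))"
    proof (rule sum_multicount_gen[OF finite_V early_fin], clarify)
      fix l
      show "card {r \<in> V. r \<in> nonnbrs (f (par l))} = card (nonnbrs (f (par l)))"
        by (intro arg_cong[of _ _ card]) (auto simp: nonnbrs_def)
    qed
    also have "\<dots> \<le> (\<Sum>l\<in>?L. 2 * D)"
      using fW parI by (intro sum_mono) (auto simp: W_def early_def)
    finally have "(3 * D + 1) * (card ?L - D) \<le> 2 * D * card ?L" by (simp add: mult.commute)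
    moreover obtain c where "card ?L = 3 * D + c" using t le_Suc_ex by blast
    ultimately have "(3 * D + 1) * (2 * D + c) \<le> 2 * D * (3 * D + c)" by simp
    then have "2 * D + c + D * c \<le> 0" by (simp add: algebra_simps)
    then show False using D_pos by simp
  qed
  have Bad_small: "card (Bad f) \<le> 3 * D + 10 * h" if fW: "\<And>j. j < t \<Longrightarrow> j \<in> I \<Longrightarrow> f j \<in> W" for f
  proof -
    have RV: "R f \<subseteq> V" "finite (R f)" using finite_V by (auto simp: R_def)
    have "card (Bad f) * D \<le> (\<Sum>v\<in>V. card (nonnbrs v \<inter> R f))"
      unfolding Bad_def by (rule card_filter_mult_le_sum[OF finite_V])
    also have "\<dots> = (\<Sum>v\<in>V. card {r \<in> R f. r \<in> nonnbrs v})"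
      by (intro sum.cong arg_cong[of _ _ card]) auto
    also have "\<dots> = (\<Sum>r\<in>R f. card (nonnbrs r))"
    proof (rule sum_multicount_gen[OF finite_V RV(2)], clarify)
      fix r assume "r \<in> R f"
      then show "card {v \<in> V. r \<in> nonnbrs v} = card (nonnbrs r)"
        using RV(1) nonnbrs_sym by (intro arg_cong[of _ _ card]) (auto simp: nonnbrs_def)
    qed
    also have "\<dots> \<le> (\<Sum>r\<in>R f. D + (card (nonnbrs r) - D))" by (intro sum_mono) simp
    also have "\<dots> = card (R f) * D + (\<Sum>r\<in>R f. card (nonnbrs r) - D)" by (simp add: sum.distrib)
    also have "\<dots> \<le> 3 * D * D + (\<Sum>r\<in>V. card (nonnbrs r) - D)"
      using R_small[OF fW] RV(1) finite_V by (intro add_mono mult_le_mono1 sum_mono2) auto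
    also have "\<dots> \<le> (3 * D + 10 * h) * D" using excess by (simp add: algebra_simps)
    finally show ?thesis using D_pos by simp
  qed
  obtain f where f: "inj_on f I" and fC: "\<And>i. i \<in> I \<Longrightarrow> f i \<in> C i f"
    "\<And>i. i \<in> I \<Longrightarrow> f i \<notin> blocked f i"
  proof (rule greedy_nonleaves[of C "2 * D", folded I_def])
    fix i and f g :: "nat \<Rightarrow> 'a" assume fg: "\<And>j. j < i \<Longrightarrow> f j = g j"
    have "Bad f = Bad g" if "t \<le> i"
    proof -
      have "f (par l) = g (par l)" if "l \<in> ?L" for l
        using that \<open>t \<le> i\<close> by (intro fg) (auto simp: early_def)
      then have "{l \<in> ?L. r \<in> nonnbrs (f (par l))} = {l \<in> ?L. r \<in> nonnbrs (g (par l))}" for r by auto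
      then show ?thesis by (simp add: Bad_def R_def)
    qed
    then show "C i f = C i g" by (auto simp: C_def)
  next
    fix i and f :: "nat \<Rightarrow> 'a"
    assume i: "i \<in> I" and prev: "\<And>j. j < i \<Longrightarrow> j \<in> I \<Longrightarrow> f j \<in> C j f"
    have "card (f ` {j \<in> I. j < i} \<inter> C i f) \<le> card I"
      by (intro surj_card_le[of _ _ f]) (auto simp: I_def)
    moreover have "card V \<le> card (C i f) + (3 * D + 20 * h)"
    proof -
      have "card (V - C i f) \<le> 3 * D + 20 * h"
      proof (cases "i < t")
        case True then show ?thesis using W by (simp add: C_def)
      next
        case False
        have "V - C i f \<subseteq> (V - W) \<union> Bad f" by (auto simp: C_def)
        then have "card (V - C i f) \<le> card ((V - W) \<union> Bad f)"
          using finite_V by (intro card_mono) (auto simp: Bad_def)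
        moreover have "card (Bad f) \<le> 3 * D + 10 * h"
          using False prev CW by (intro Bad_small) (meson less_le_trans not_less subsetD)
        ultimately show ?thesis using W card_Un_le[of "V - W" "Bad f"] by linarith
      qed
      moreover have "C i f \<subseteq> V" using CW by (auto simp: W_def)
      then have "card (V - C i f) = card V - card (C i f)"
        using finite_V finite_subset by (intro card_Diff_subset) auto
      ultimately show ?thesis by linarith
    qed
    ultimately show "2 * D + card (f ` {j \<in> I. j < i} \<inter> C i f) < card (C i f)"
      using card_nonleaves card_V L D_small D_pos by (simp add: I_def)
  qed (use CW in \<open>auto simp: W_def\<close>)
  have fW: "f i \<in> W" if "i \<in> I" for i using fC(1)[OF that] CW by auto
  show ?thesis
  proof (rule complete_leaves[of f])
    fix S Z assume SZ: "S \<subseteq> leaves" "S \<noteq> {}" "Z \<subseteq> V" "D \<le> card Z"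
      "card leaves + D \<le> card S + card Z" "\<And>l. l \<in> S \<Longrightarrow> Z \<subseteq> nonnbrs (f (par l))"
    have finS: "finite S" using SZ(1) finite_leaves finite_subset by blast
    obtain l where "l \<in> S" using SZ(2) by auto
    then have "card Z \<le> card (nonnbrs (f (par l)))" using SZ(6) by (intro card_mono) auto
    also have "\<dots> \<le> 2 * D" using fW parI SZ(1) \<open>l \<in> S\<close> by (auto simp: W_def)
    finally have "card leaves \<le> card S + D" using SZ(5) by linarith
    then have missed: "card (leaves - S) \<le> D" using SZ(1) finS by (simp add: card_Diff_subset)
    have ZR: "Z \<subseteq> R f"
    proof
      fix z assume z: "z \<in> Z"
      have "?L - (leaves - S) \<subseteq> {l \<in> ?L. z \<in> nonnbrs (f (par l))}" using SZ(6) z by (auto simp: early_def)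
      then have "card (?L - (leaves - S)) \<le> card {l \<in> ?L. z \<in> nonnbrs (f (par l))}"
        using early_fin by (intro card_mono) auto
      moreover have "card ?L - card (leaves - S) \<le> card (?L - (leaves - S))"
        using finite_leaves by (intro diff_card_le_card_Diff) simp
      ultimately show "z \<in> R f" using missed SZ(3) z by (auto simp: R_def)
    qed
    have "\<not> S \<subseteq> ?L"
    proof
      assume "S \<subseteq> ?L"
      then have "card S \<le> card ?L" using early_fin by (rule card_mono[rotated])
      with t_max \<open>card leaves \<le> card S + D\<close> L D_small h_pos show False by linarith
    qed
    then obtain l where l: "l \<in> S" "l \<notin> ?L" by auto
    then have "par l \<in> I" "\<not> par l < t" using SZ(1) parI by (auto simp: early_def)
    then have "f (par l) \<notin> Bad f" "f (par l) \<in> V"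
      using fC(1)[of "par l"] by (auto simp: C_def W_def)
    then have "card (nonnbrs (f (par l)) \<inter> R f) < D" by (simp add: Bad_def)
    moreover have "card Z \<le> card (nonnbrs (f (par l)) \<inter> R f)"
      using SZ(6)[OF l(1)] ZR by (intro card_mono) auto
    ultimately show False using SZ(4) by linarith
  qed (use f fC fW in \<open>auto simp: I_def W_def\<close>)
qed

end

subsection \<open>Trees with few leaves\<close>

context parent_tree
begin

lemma sum_card_children: "finite S \<Longrightarrow> (\<Sum>v\<in>S. card (children k par v)) = card {i \<in> {1..k}. par i \<in> S}"
proof -
  assume "finite S"
  then have "(\<Sum>v\<in>S. card (children k par v)) = card (\<Union>v\<in>S. children k par v)"
    by (intro card_UN_disjoint[symmetric]) (auto simp: children_def)
  also have "(\<Union>v\<in>S. children k par v) = {i \<in> {1..k}. par i \<in> S}" by (auto simp: children_def)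
  finally show ?thesis .
qed

text \<open>
  In a tree the numbers \<open>c - 1\<close>, where \<open>c\<close> counts the children of a vertex, add up to \<open>-1\<close>. Hence the
  sum of \<open>c - 1\<close> over the branching vertices is less than the number of childless ones, and
  \<open>c \<le> 2 (c - 1)\<close> for \<open>c \<ge> 2\<close>.
\<close>

lemma card_branching_children:
  "card {i \<in> {1..k}. 2 \<le> card (children k par (par i))} \<le> 2 * card {v. v \<le> k \<and> children k par v = {}}"
proof -
  let ?c = "\<lambda>v. card (children k par v)"
  let ?Br = "{v. v \<le> k \<and> 2 \<le> ?c v}"
  have pk: "par i \<le> k" if "i \<in> {1..k}" for i using par_less[OF that] that by auto
  have "{i \<in> {1..k}. par i \<in> {..k}} = {1..k}" using pk by auto
  then have total: "(\<Sum>v\<le>k. ?c v) = k" using sum_card_children[of "{..k}"] by simp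
  have "(\<Sum>v\<le>k. ?c v + (if ?c v = 0 then 1 else 0)) = (\<Sum>v\<le>k. 1 + (?c v - 1))"
  proof (rule sum.cong[OF refl])
    have "x + (if x = 0 then 1 else 0) = 1 + (x - 1)" for x :: nat by simp
    then show "?c v + (if ?c v = 0 then 1 else 0) = 1 + (?c v - 1)" for v .
  qed
  moreover have "(\<Sum>v\<le>k. if ?c v = 0 then 1 else 0 :: nat) = (\<Sum>v\<in>{v. v \<le> k \<and> children k par v = {}}. 1)"
    by (intro sum.mono_neutral_cong_right) auto
  ultimately have "(\<Sum>v\<le>k. ?c v - 1) < card {v. v \<le> k \<and> children k par v = {}}"
    using total unfolding sum.distrib by simp
  moreover have "(\<Sum>v\<in>?Br. ?c v) \<le> (\<Sum>v\<in>?Br. 2 * (?c v - 1))" by (intro sum_mono) auto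
  moreover have "(\<Sum>v\<in>?Br. 2 * (?c v - 1)) \<le> (\<Sum>v\<le>k. 2 * (?c v - 1))"
    by (intro sum_mono2) auto
  moreover have "(\<Sum>v\<in>?Br. ?c v) = card {i \<in> {1..k}. par i \<in> ?Br}"
    by (rule sum_card_children) simp
  moreover have "{i \<in> {1..k}. par i \<in> ?Br} = {i \<in> {1..k}. 2 \<le> ?c (par i)}" using pk by auto
  ultimately show ?thesis by (simp add: sum_distrib_left[symmetric])
qed

end

context tree_in_dense_host
begin

text \<open>
  The lower ends \<open>c\<close> of paths \<open>par (par c), par c, c\<close> in which the two upper vertices have no other
  children. They are taken from the first \<open>4000 h\<close> vertices of the tree in order that a given vertex
  of the host, which has at least \<open>5000 h\<close> neighbours, still has free ones when the path is placed.
\<close>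

definition path_ends :: "nat set" where
  "path_ends = {c \<in> {1..<4000 * h}. 1 \<le> par c \<and>
     card (children k par (par c)) = 1 \<and> card (children k par (par (par c))) = 1}"

lemma children_eq_singleton:
  assumes "i \<in> {1..k}" "card (children k par (par i)) = 1"
  shows "children k par (par i) = {i}"
proof -
  obtain x where "children k par (par i) = {x}" using assms(2) card_1_singletonE by blast
  moreover have "i \<in> children k par (par i)" using assms(1) by (simp add: children_def)
  ultimately show ?thesis by simp
qed

lemma card_path_ends:
  assumes L: "card leaves < 100 * h"
  shows "3600 * h \<le> card path_ends + 2"
proof -
  let ?c = "\<lambda>v. card (children k par v)"
  let ?X = "{i \<in> {1..k}. 2 \<le> ?c (par i)}"
  let ?Y = "{i \<in> {1..k}. ?c (par i) = 1 \<and> par i \<in> ?X}"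
  let ?O = "{i \<in> {1..k}. ?c (par i) = 1 \<and> par i = 0}"
  have X: "card ?X \<le> 2 * card leaves" using card_branching_children by (simp add: leaves_def)
  have "inj_on par ?Y" using children_eq_singleton by (intro inj_onI) (metis (mono_tags, lifting) mem_Collect_eq singleton_inject)
  then have "card ?Y \<le> card ?X" by (rule card_inj_on_le) auto
  moreover have "card ?O \<le> 1"
  proof (cases "?c 0 = 1")
    case True
    have "card ?O \<le> ?c 0" by (intro card_mono) (auto simp: children_def)
    with True show ?thesis by simp
  next
    case False
    then have "i \<notin> ?O" for i by (cases "par i = 0") simp_all
    then have O: "?O = {}" by blast
    show ?thesis unfolding O by simp
  qed
  moreover have "{1..<4000 * h} \<subseteq> path_ends \<union> (?X \<union> (?Y \<union> ?O))"
  proof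
    fix i assume i: "i \<in> {1..<4000 * h}"
    then have ik: "i \<in> {1..k}" using h by auto
    have pos: "1 \<le> ?c (par j)" if "j \<in> {1..k}" for j
    proof -
      have "j \<in> children k par (par j)" using that by (simp add: children_def)
      then show ?thesis by (metis One_nat_def Suc_leI card_gt_0_iff empty_iff finite_children)
    qed
    have "par i \<in> {1..k}" if "par i \<noteq> 0" using that par_less[OF ik] ik by auto
    then show "i \<in> path_ends \<union> (?X \<union> (?Y \<union> ?O))"
      using pos[OF ik] pos[of "par i"] i ik by (auto simp: path_ends_def)
  qed
  then have "card {1..<4000 * h} \<le> card (path_ends \<union> (?X \<union> (?Y \<union> ?O)))"
    by (intro card_mono) (auto simp: path_ends_def)
  moreover have "card (path_ends \<union> (?X \<union> (?Y \<union> ?O))) \<le> card path_ends + (card ?X + (card ?Y + card ?O))"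
    by (meson card_Un_le order_trans add_mono order_refl)
  ultimately show ?thesis using X L h_pos by simp
qed

text \<open>
  Fixing the depth modulo 3 makes the chosen paths disjoint and their middle vertices independent.
  The bijection \<open>b\<close> assigns the vertices of the host that are not good to the paths with lower ends
  in \<open>KB\<close>; the ends of such a path are placed on good neighbours of its \<open>b c\<close>. The middle vertices
  of the other paths form the set \<open>M\<close> that is placed at the end. An obstruction has \<open>|Z| \<le> 2 h\<close>
  since both ends of a path are on good vertices, hence \<open>S\<close> has more than \<open>h\<close> members. But any
  \<open>z \<in> Z\<close> is good, as all other vertices are used, and each member of \<open>S\<close> accounts for a nonneighbour
  of \<open>z\<close> of its own.
\<close>

lemma hosts_few_leaves:
  assumes L: "card leaves < 100 * h" and deg: "\<And>v. v \<in> V \<Longrightarrow> k \<le> 2 * card {w \<in> V. (v, w) \<in> E}"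
  shows "hosts V E k par"
proof -
  let ?d = "\<lambda>i. depth par i mod 3"
  have "\<exists>q<3. 1100 * h \<le> card {c \<in> path_ends. ?d c = q}"
  proof (rule ccontr)
    assume "\<not> ?thesis"
    then have "card {c \<in> path_ends. ?d c = q} < 1100 * h" if "q < 3" for q using that by (meson not_le)
    from this[of 0] this[of 1] this[of 2]
    have "card {c \<in> path_ends. ?d c = 0} + (card {c \<in> path_ends. ?d c = 1} + card {c \<in> path_ends. ?d c = 2}) < 3300 * h"
      by simp
    moreover have "path_ends \<subseteq> {c \<in> path_ends. ?d c = 0} \<union> ({c \<in> path_ends. ?d c = 1} \<union> {c \<in> path_ends. ?d c = 2})"
    proof -
      have "m mod 3 = 0 \<or> m mod 3 = 1 \<or> m mod 3 = 2" for m :: nat by presburger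
      then show ?thesis by blast
    qed
    then have "card path_ends \<le> card ({c \<in> path_ends. ?d c = 0} \<union> ({c \<in> path_ends. ?d c = 1} \<union> {c \<in> path_ends. ?d c = 2}))"
      by (intro card_mono) (auto simp: path_ends_def)
    moreover have "\<dots> \<le> card {c \<in> path_ends. ?d c = 0} + (card {c \<in> path_ends. ?d c = 1} + card {c \<in> path_ends. ?d c = 2})"
      by (meson card_Un_le order_trans add_mono order_refl)
    ultimately show False using card_path_ends[OF L] h_pos by linarith
  qed
  then obtain q where q: "1100 * h \<le> card {c \<in> path_ends. ?d c = q}" by auto
  define K where "K = {c \<in> path_ends. ?d c = q}"
  have finK: "finite K" by (auto simp: K_def path_ends_def)
  have K: "c \<in> {1..k}" "par c \<in> {1..k}" "children k par (par c) = {c}"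
    "children k par (par (par c)) = {par c}" "c < 4000 * h" "?d c = q" if "c \<in> K" for c
  proof -
    show 1: "c \<in> {1..k}" "c < 4000 * h" "?d c = q" using that h by (auto simp: K_def path_ends_def)
    then show 2: "par c \<in> {1..k}" using that par_less[of c] by (auto simp: K_def path_ends_def)
    show "children k par (par c) = {c}" "children k par (par (par c)) = {par c}"
      using that 1 2 by (auto intro!: children_eq_singleton simp del: One_nat_def simp: K_def path_ends_def)
  qed
  have par_inj: "c = c'" if "c \<in> K" "c' \<in> K" "par c = par c'" for c c'
    using K(3)[OF that(1)] K(3)[OF that(2)] that(3) by (metis singleton_inject)
  have par2_inj: "c = c'" if "c \<in> K" "c' \<in> K" "par (par c) = par (par c')" for c c'
    using K(4)[OF that(1)] K(4)[OF that(2)] that by (metis singleton_inject par_inj)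
  have not_par: "c' \<noteq> par c" "c' \<noteq> par (par c)" "par c' \<noteq> par (par c)" if "c \<in> K" "c' \<in> K" for c c'
  proof -
    define d where "d = depth par (par (par c))"
    have d: "depth par (par c) = Suc d" "depth par c = Suc (Suc d)"
      "depth par c' = Suc (depth par (par c'))"
      using K(1,2)[OF that(1)] K(1)[OF that(2)] depth_par by (simp_all add: d_def del: One_nat_def)
    have e: "Suc (Suc d) mod 3 = ?d c'" using K(6)[OF that(1)] K(6)[OF that(2)] by (simp only: d(2))
    have "Suc d mod 3 \<noteq> Suc (Suc d) mod 3" "d mod 3 \<noteq> Suc (Suc d) mod 3" by presburger+
    then have "depth par c' \<noteq> Suc d" "depth par c' \<noteq> d" using e by auto
    then show "c' \<noteq> par c" "c' \<noteq> par (par c)" "par c' \<noteq> par (par c)"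
      using d(1,3) d_def by auto
  qed
  have "card (V - good) \<le> card K" using card_not_good q h_pos by (simp add: K_def)
  then obtain KB where KB: "KB \<subseteq> K" "card KB = card (V - good)"
    by (meson obtain_subset_with_card_n)
  have finKB: "finite KB" using KB(1) finK finite_subset by blast
  then obtain b where b: "bij_betw b KB (V - good)"
    using KB(2) finite_V by (meson finite_Diff finite_same_card_bij)
  have bV: "b c \<in> V" "b c \<notin> good" if "c \<in> KB" for c using b that by (auto simp: bij_betw_def)
  define M where "M = par ` (K - KB)"
  have cM: "card M + h \<ge> 1100 * h"
  proof -
    have "card M = card (K - KB)" unfolding M_def using par_inj by (intro card_image inj_onI) auto
    also have "\<dots> = card K - card KB" using KB(1) finKB by (simp add: card_Diff_subset)
    finally show ?thesis using q KB(2) card_not_good by (simp add: K_def)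
  qed
  have Mk: "M \<subseteq> {1..k}" using K(2) by (auto simp: M_def)
  define I where "I = {..k} - M"
  have cI: "card I + 1099 * h \<le> k + 1"
  proof -
    have "card I = card {..k} - card M" unfolding I_def
      using Mk by (intro card_Diff_subset) (auto intro: finite_subset)
    moreover have "card M \<le> card {..k}" using Mk by (intro card_mono) auto
    ultimately show ?thesis using cM by simp
  qed
  \<comment> \<open>a vertex whose parent is left to the end is unrestricted for the moment\<close>
  define N where "N f i = (if i = 0 \<or> par i \<in> M then {} else nonnbrs (f (par i)))" for f :: "nat \<Rightarrow> 'a" and i
  define C where "C f i =
    (if i \<in> KB then {w \<in> good. (b i, w) \<in> E}
     else if i \<in> par ` KB then {b (the_inv_into KB par i)}
     else if i \<in> par ` par ` KB then {w \<in> good. (b (the_inv_into KB (par \<circ> par) i), w) \<in> E} - N f i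
     else good - N f i)" for f i
  have injs: "inj_on par KB" "inj_on (par \<circ> par) KB"
    using KB(1) by (auto intro!: inj_onI intro: par_inj par2_inj subsetD)
  have C_end: "C f c = {w \<in> good. (b c, w) \<in> E}" if "c \<in> KB" for f c
    using that by (simp add: C_def)
  have C_mid: "C f (par c) = {b c}" if "c \<in> KB" for f c
  proof -
    have "par c \<notin> KB" using not_par(1)[of c] that KB(1) by blast
    with that show ?thesis by (simp add: C_def the_inv_into_f_f[OF injs(1)])
  qed
  have C_top: "C f (par (par c)) = {w \<in> good. (b c, w) \<in> E} - N f (par (par c))" if "c \<in> KB" for f c
  proof -
    have "par (par c) \<notin> KB" "par (par c) \<notin> par ` KB"
      using not_par(2)[of c] not_par(3)[of c] that KB(1) by auto blast+
    moreover have "the_inv_into KB (par \<circ> par) (par (par c)) = c"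
      using the_inv_into_f_f[OF injs(2) that] by simp
    ultimately show ?thesis using that by (simp add: C_def)
  qed
  have C_good: "C f i \<subseteq> good" if "i \<notin> par ` KB" for f i
    using that by (auto simp: C_def)
  have C_other: "C f i = good - N f i" if "i \<notin> KB" "i \<notin> par ` KB" "i \<notin> par ` par ` KB" for f i
    using that by (simp add: C_def)
  have nbrs: "5000 * h \<le> card {w \<in> good. (v, w) \<in> E} + h" if "v \<in> V" for v
  proof -
    have "{w \<in> V. (v, w) \<in> E} \<subseteq> {w \<in> good. (v, w) \<in> E} \<union> (V - good)" by auto
    then have "card {w \<in> V. (v, w) \<in> E} \<le> card ({w \<in> good. (v, w) \<in> E} \<union> (V - good))"
      using finite_V by (intro card_mono) (auto simp: good_def)
    then show ?thesis
      using deg[OF that] h card_not_good card_Un_le[of "{w \<in> good. (v, w) \<in> E}" "V - good"] by linarith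
  qed
  have fin: "finite good" using finite_V by (simp add: good_def)
  obtain f where f: "inj_on f I" and fC: "\<And>i. i \<in> I \<Longrightarrow> f i \<in> C f i"
  proof (rule sequential_choice[where I = I and A = "\<lambda>i f. if i \<in> I then C f i else {}"])
    fix i and f g :: "nat \<Rightarrow> 'a" assume fg: "\<And>j. j < i \<Longrightarrow> f j = g j"
    have "N f i = N g i" if "i \<in> I" using that par_less[of i] fg[of "par i"] by (auto simp: N_def I_def)
    then show "(if i \<in> I then C f i else {}) = (if i \<in> I then C g i else {})" by (auto simp: C_def)
  next
    fix i and f :: "nat \<Rightarrow> 'a"
    assume i: "i \<in> I" and prev': "\<And>j. j < i \<Longrightarrow> j \<in> I \<Longrightarrow> f j \<in> (if j \<in> I then C f j else {})"
    then have prev: "\<And>j. j < i \<Longrightarrow> j \<in> I \<Longrightarrow> f j \<in> C f j" by simp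
    let ?Q = "f ` {j \<in> I. j < i}"
    have finN: "finite (N f i)" by (simp add: N_def)
    have N_small: "card (N f i) \<le> h" if "i \<notin> KB"
    proof (cases "i = 0 \<or> par i \<in> M")
      case False
      then have p: "i \<in> {1..k}" "par i < i" "par i \<in> I"
        using i par_less[of i] by (auto simp: I_def)
      have "par i \<notin> par ` KB"
      proof
        assume "par i \<in> par ` KB"
        then obtain c where c: "c \<in> KB" "par i = par c" by auto
        then have "i \<in> children k par (par c)" using p by (simp add: children_def)
        then show False using K(3)[of c] c KB(1) that by auto
      qed
      then have "f (par i) \<in> good" using prev[of "par i"] p C_good by blast
      then show ?thesis using False by (simp add: N_def good_def)
    qed (auto simp: N_def)
    have "{j \<in> I. j < i} \<subseteq> {..<i}" by auto
    then have Q_small: "card ?Q \<le> i"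
      by (metis card_lessThan card_mono finite_lessThan surj_card_le image_mono order_trans card_image_le)
    have finQ: "finite ?Q" by (simp add: I_def)
    have "\<exists>x\<in>C f i. x \<notin> ?Q"
    proof -
      consider c where "c \<in> KB" "i = c" | c where "c \<in> KB" "i = par c" | c where "c \<in> KB" "i = par (par c)"
        | "i \<notin> KB" "i \<notin> par ` KB" "i \<notin> par ` par ` KB" by blast
      then show ?thesis
      proof cases
        case 1
        then have "i < 4000 * h" using K(5) KB(1) by auto
        then have "card {} + card ?Q < card {w \<in> good. (b c, w) \<in> E}"
          using nbrs[OF bV(1)[OF 1(1)]] Q_small h_pos by simp
        from exists_outside[OF finite.emptyI finQ this] show ?thesis
          unfolding 1(2) C_end[OF 1(1)] Diff_empty .
      next
        case 2
        have "b c \<notin> ?Q"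
        proof
          assume "b c \<in> ?Q"
          then obtain j where j: "j \<in> I" "j < i" "b c = f j" by auto
          show False
          proof (cases "j \<in> par ` KB")
            case True
            then obtain c' where c': "c' \<in> KB" "j = par c'" by auto
            then have "b c = b c'" using prev[of j] j C_mid by auto
            then have "c = c'" using b 2(1) c'(1) by (auto simp: bij_betw_def dest: inj_onD)
            then show False using c' j 2 by simp
          next
            case False
            then show False using prev[of j] j C_good bV(2)[OF 2(1)] by auto
          qed
        qed
        then show ?thesis using 2 C_mid by simp
      next
        case 3
        have cK: "c \<in> K" using 3 KB(1) by auto
        then have "i < 4000 * h" using 3(2) K(1,2,5)[OF cK] par_less[of c] par_less[of "par c"] by simp
        moreover have "i \<notin> KB" using not_par(2)[OF cK] 3(2) KB(1) by auto
        ultimately have "card (N f i) + card ?Q < card {w \<in> good. (b c, w) \<in> E}"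
          using nbrs[OF bV(1)[OF 3(1)]] Q_small h_pos N_small by simp
        from exists_outside[OF finN finQ this] show ?thesis unfolding 3(2) C_top[OF 3(1)] .
      next
        case 4
        have "card ?Q \<le> card I" by (intro surj_card_le[of _ _ f]) (auto simp: I_def)
        then have "card (N f i) + card ?Q < card good"
          using cI card_good N_small[OF 4(1)] h_pos by linarith
        from exists_outside[OF finN finQ this] show ?thesis unfolding C_other[OF 4] .
      qed
    qed
    then show "\<exists>x\<in>if i \<in> I then C f i else {}. x \<notin> ?Q" using i by simp
  qed (use that in auto)
  have f_good: "f i \<in> good" if "i \<in> I" "i \<notin> par ` KB" for i using fC[OF that(1)] C_good[OF that(2)] by blast
  have KI: "c \<in> I" "par (par c) \<in> I" if "c \<in> K" for c
    using that K(1,2)[OF that] par_less[of "par c"] not_par[of _ c] not_par(3)[of c]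
    by (auto simp: I_def M_def) (metis not_par)+
  have midI: "par c \<in> I" if "c \<in> KB" for c
    using that KB(1) K(2) par_inj by (fastforce simp: I_def M_def)
  have f_mid: "f (par c) = b c" if "c \<in> KB" for c using fC[OF midI[OF that]] C_mid[OF that] by simp
  show ?thesis
  proof (rule complete_placement[of M f, folded I_def])
    show "M \<subseteq> {1..k}" by (rule Mk)
    show "par i \<notin> M" if "i \<in> M" for i
      using that not_par(3) by (auto simp: M_def) metis
    show "inj_on f I" by (rule f)
    show "f ` I \<subseteq> V"
    proof
      fix x assume "x \<in> f ` I"
      then obtain i where "i \<in> I" "x = f i" by auto
      then show "x \<in> V" using f_good[of i] f_mid bV by (cases "i \<in> par ` KB") (auto simp: good_def)
    qed
    show "(f (par i), f i) \<in> E" if i: "i \<in> {1..k} - M" and pM: "par i \<notin> M" for i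
    proof -
      have iI: "i \<in> I" "par i \<in> I" "par i \<noteq> i" using i pM par_less[of i] by (auto simp: I_def)
      consider c where "c \<in> KB" "i = c" | c where "c \<in> KB" "i = par c"
        | "i \<notin> KB" "i \<notin> par ` KB" by blast
      then show ?thesis
      proof cases
        case 1
        then show ?thesis using fC[OF iI(1)] C_end f_mid by simp
      next
        case 2
        then have "(b c, f (par i)) \<in> E" using fC[OF iI(2)] C_top[OF 2(1)] by simp
        then show ?thesis using 2 f_mid by (simp add: sym_E)
      next
        case 3
        then have "f i \<in> good" "f i \<notin> N f i" using fC[OF iI(1)] by (auto simp: C_def split: if_splits)
        moreover have "f i \<noteq> f (par i)" using f iI by (auto dest: inj_onD)
        ultimately show ?thesis using i pM by (auto simp: N_def nonnbrs_def good_def)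
      qed
    qed
    fix S Z assume SZ: "S \<subseteq> M" "S \<noteq> {}" "Z \<subseteq> V - f ` I" "D \<le> card Z" "card M + D \<le> card S + card Z"
      "\<And>m z. m \<in> S \<Longrightarrow> z \<in> Z \<Longrightarrow> z \<in> nonnbrs (f (par m)) \<or> (\<exists>j\<in>children k par m. z \<in> nonnbrs (f j))"
    define SC where "SC = {c \<in> K - KB. par c \<in> S}"
    have S_eq: "S = par ` SC" using SZ(1) by (auto simp: SC_def M_def)
    have cS: "card S = card SC" unfolding S_eq using par_inj by (intro card_image inj_onI) (auto simp: SC_def)
    have cover: "z \<in> nonnbrs (f (par (par c))) \<or> z \<in> nonnbrs (f c)" if "c \<in> SC" "z \<in> Z" for c z
      using SZ(6)[of "par c" z] that K(3)[of c] by (auto simp: SC_def)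
    have good_ends: "f (par (par c)) \<in> good" "f c \<in> good" if "c \<in> SC" for c
    proof -
      have c: "c \<in> K" using that by (simp add: SC_def)
      have "c \<notin> par ` KB" "par (par c) \<notin> par ` KB"
        using not_par(1)[of _ c] not_par(3)[of c] c KB(1) by auto blast+
      then show "f (par (par c)) \<in> good" "f c \<in> good" using f_good KI[OF c] by auto
    qed
    have "card Z \<le> 2 * h"
    proof -
      obtain c where c: "c \<in> SC" using SZ(2) S_eq by auto
      have "Z \<subseteq> nonnbrs (f (par (par c))) \<union> nonnbrs (f c)" using cover[OF c] by auto
      then have "card Z \<le> card (nonnbrs (f (par (par c))) \<union> nonnbrs (f c))" by (intro card_mono) auto
      with good_ends[OF c] card_Un_le[of "nonnbrs (f (par (par c)))" "nonnbrs (f c)"] show ?thesis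
        by (simp add: good_def)
    qed
    moreover have "card SC \<le> h"
    proof -
      obtain z where z: "z \<in> Z" using SZ(4) D_pos by (metis card.empty equals0I not_one_le_zero order_trans)
      have zg: "z \<in> good"
      proof (rule ccontr)
        assume "z \<notin> good"
        then have "z \<in> b ` KB" using z SZ(3) b by (auto simp: bij_betw_def)
        then obtain c where "c \<in> KB" "z = f (par c)" using f_mid by auto
        then show False using z SZ(3) midI by auto
      qed
      \<comment> \<open>an end of the path whose image is a nonneighbour of \<open>z\<close>\<close>
      define g where "g c = (if z \<in> nonnbrs (f (par (par c))) then par (par c) else c)" for c
      have gI: "g c \<in> I" if "c \<in> SC" for c using that KI by (auto simp: g_def SC_def)
      have "inj_on g SC"
      proof (rule inj_onI)
        fix c c' assume cc: "c \<in> SC" "c' \<in> SC" "g c = g c'"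
        then have "c \<in> K" "c' \<in> K" by (auto simp: SC_def)
        then show "c = c'" using cc(3) par2_inj not_par(2)[of c c'] not_par(2)[of c' c]
          by (auto simp: g_def split: if_splits)
      qed
      then have "inj_on (f \<circ> g) SC" using f gI by (intro comp_inj_on) (auto intro: inj_on_subset)
      moreover have "(f \<circ> g) ` SC \<subseteq> nonnbrs z"
      proof
        fix x assume "x \<in> (f \<circ> g) ` SC"
        then obtain c where c: "c \<in> SC" "x = f (g c)" by auto
        then have "z \<in> nonnbrs x" using cover[OF c(1) z] by (auto simp: g_def)
        moreover have "x \<in> V" using c good_ends[OF c(1)] by (auto simp: g_def good_def)
        ultimately show "x \<in> nonnbrs z" using nonnbrs_sym zg by (auto simp: good_def)
      qed
      ultimately have "card SC \<le> card (nonnbrs z)" by (rule card_inj_on_le) simp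
      then show ?thesis using zg by (simp add: good_def)
    qed
    ultimately show False using SZ(5) cS cM h_pos by linarith
  qed
qed

lemma hosts_dense:
  assumes deg: "\<And>v. v \<in> V \<Longrightarrow> k \<le> 2 * card {w \<in> V. (v, w) \<in> E}"
    and children_le: "\<And>i. i \<le> k \<Longrightarrow> card (children k par i) \<le> h"
  shows "hosts V E k par"
proof (cases "card leaves < 100 * h")
  case True then show ?thesis using deg by (rule hosts_few_leaves)
next
  case False
  then show ?thesis
    using hosts_many_leaves_many_low hosts_many_leaves_few_low children_le
    by (cases "card low < 10 * h") auto
qed

end

section \<open>Counting edges of the host graph\<close>

context pair_graph
begin

lemma degree_eq_card_neighbours: "degree G v = card {w \<in> pverts G. (v, w) \<in> parcs G}"
proof -
  have "out_arcs (with_proj G) v = Pair v ` {w \<in> pverts G. (v, w) \<in> parcs G}"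
    using wellformed' by (auto simp: out_arcs_def)
  then show ?thesis
    unfolding degree_def out_degree_def by (simp add: card_image inj_on_def)
qed

lemma sum_degree: "(\<Sum>v\<in>pverts G. degree G v) = card (parcs G)"
proof -
  have "parcs G = Sigma (pverts G) (\<lambda>v. {w \<in> pverts G. (v, w) \<in> parcs G})"
    using wellformed' by auto
  then have "card (parcs G) = card (Sigma (pverts G) (\<lambda>v. {w \<in> pverts G. (v, w) \<in> parcs G}))"
    by (rule arg_cong)
  also have "\<dots> = (\<Sum>v\<in>pverts G. card {w \<in> pverts G. (v, w) \<in> parcs G})"
    using pair_finite_verts by (intro card_SigmaI) simp_all
  finally show ?thesis by (simp add: degree_eq_card_neighbours)
qed

text \<open>
  Handshaking inside \<open>S\<close>: an edge consists of two arcs.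
\<close>

lemma card_arcs_within: "card (parcs G \<inter> S \<times> S) = 2 * edges_within G S"
proof -
  let ?F = "{e \<in> edges G. e \<subseteq> S}"
  let ?o = "\<lambda>e. {p \<in> parcs G. {fst p, snd p} = e}"
  have "edges G = (\<lambda>(u, w). {u, w}) ` parcs G" by (force simp: edges_def)
  then have finF: "finite ?F" using pair_finite_arcs by simp
  have "parcs G \<inter> S \<times> S = (\<Union>e\<in>?F. ?o e)"
    by (fastforce simp: edges_def)
  then have "card (parcs G \<inter> S \<times> S) = (\<Sum>e\<in>?F. card (?o e))"
    using pair_finite_arcs finF by (simp add: card_UN_disjoint disjoint_iff)
  also have "\<dots> = (\<Sum>e\<in>?F. 2)"
  proof (rule sum.cong[OF refl])
    fix e assume "e \<in> ?F"
    then obtain u w where uw: "(u, w) \<in> parcs G" "e = {u, w}" by (auto simp: edges_def)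
    then have "?o e = {(u, w), (w, u)}" using arcs_symmetric by (auto simp: doubleton_eq_iff)
    moreover have "u \<noteq> w" using uw(1) pair_no_loops by force
    ultimately show "card (?o e) = 2" by simp
  qed
  finally show ?thesis by (simp add: edges_within_def)
qed

lemma card_arcs: "card (parcs G) = 2 * card (edges G)"
proof -
  have "parcs G \<inter> pverts G \<times> pverts G = parcs G" using wellformed' by auto
  moreover have "{e \<in> edges G. e \<subseteq> pverts G} = edges G" using wellformed' by (auto simp: edges_def)
  ultimately show ?thesis using card_arcs_within[of "pverts G"] by (simp add: edges_within_def)
qed

lemma card_cross_arcs:
  assumes "A \<union> B = pverts G" "A \<inter> B = {}"
  shows "card (parcs G \<inter> A \<times> B) + (edges_within G A + edges_within G B) = card (edges G)"
proof -
  let ?AA = "parcs G \<inter> A \<times> A" and ?BB = "parcs G \<inter> B \<times> B"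
  let ?AB = "parcs G \<inter> A \<times> B" and ?BA = "parcs G \<inter> B \<times> A"
  have fin: "finite ?AA" "finite ?BB" "finite ?AB" "finite ?BA" using pair_finite_arcs by auto
  have "parcs G = ?AA \<union> (?BB \<union> (?AB \<union> ?BA))" using assms(1) wellformed' by fast
  then have "card (parcs G) = card (?AA \<union> (?BB \<union> (?AB \<union> ?BA)))" by simp
  also have "\<dots> = card ?AA + (card ?BB + (card ?AB + card ?BA))"
  proof -
    have d: "?AB \<inter> ?BA = {}" "?BB \<inter> (?AB \<union> ?BA) = {}" "?AA \<inter> (?BB \<union> (?AB \<union> ?BA)) = {}"
      using assms(2) by auto
    show ?thesis using fin by (simp only: card_Un_disjoint[OF _ _ d(3)] card_Un_disjoint[OF _ _ d(2)]
      card_Un_disjoint[OF _ _ d(1)] finite_Un)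
  qed
  also have "card ?BA = card ?AB"
  proof (rule bij_betw_same_card[of prod.swap])
    show "bij_betw prod.swap ?BA ?AB"
      using arcs_symmetric by (intro bij_betwI[of _ _ _ prod.swap]) auto
  qed
  finally show ?thesis using card_arcs_within card_arcs by simp
qed

end

section \<open>The embedding theorem\<close>

lemma card_arcs_gt:
  assumes "pair_graph G" "average_degree G > real k - 1" "1 \<le> k"
  shows "(real k - 1) * real (card (pverts G)) < real (card (parcs G))"
proof -
  interpret G: pair_graph G by fact
  have "0 < average_degree G" using assms(2,3) by linarith
  then have "0 < card (pverts G)" by (auto simp: average_degree_def intro: gr0I)
  moreover have "average_degree G = real (card (parcs G)) / real (card (pverts G))"
    by (simp add: average_degree_def flip: G.sum_degree)
  ultimately show ?thesis using assms(2) by (simp add: pos_less_divide_eq)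
qed

text \<open>
  The bound on \<open>|G|\<close> gives \<open>10\<^sup>1\<^sup>1 D \<le> k\<close>. A vertex with \<open>c\<close> children satisfies \<open>10\<^sup>6 c\<^sup>2 \<le> k\<close>, whence
  \<open>10\<^sup>4 c \<le> k\<close>.
\<close>

lemma contains_dense:
  fixes G :: "'a pair_pre_digraph" and T :: "'b pair_pre_digraph"
  assumes "pair_graph G"
    and "average_degree G > real k - 1"
    and "real (min_degree G) \<ge> real k / 2"
    and k: "1 \<le> k" and n: "real (card (pverts G)) \<le> (1 + 1 / 10 ^ 11) * real k"
    and T: "T \<in> trees k (sqrt (real k) / 1000)"
  shows "contains G T"
proof -
  interpret G: pair_graph G by fact
  let ?n = "card (pverts G)"
  obtain v par where enc: "bij_betw v {..k} (pverts T)" "\<And>i. i \<in> {1..k} \<Longrightarrow> par i < i"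
    "parcs T = (\<Union>i\<in>{1..k}. {(v (par i), v i), (v i, v (par i))})"
    and deg: "\<And>i. i \<le> k \<Longrightarrow> real (card (children k par i)) + (if i = 0 then 0 else 1) \<le> sqrt (real k) / 1000"
    by (rule tree_parent_encoding[OF T]) (rule that)
  interpret host_graph "pverts G" "parcs G"
    using G.pair_finite_verts G.arcs_symmetric by unfold_locales auto
  have co_deg: "card (nonnbrs x) + degree G x + 1 = ?n" if "x \<in> pverts G" for x
  proof -
    let ?N = "{w \<in> pverts G. (x, w) \<in> parcs G}"
    have N: "x \<notin> ?N" "finite ?N" using G.pair_no_loops finite_V by force+
    have nonnbrs: "nonnbrs x \<inter> ?N = {}" "x \<notin> nonnbrs x" by (auto simp: nonnbrs_def)
    have "pverts G = insert x (nonnbrs x \<union> ?N)" using that by (auto simp: nonnbrs_def)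
    then have "?n = card (insert x (nonnbrs x \<union> ?N))" by (rule arg_cong)
    also have "\<dots> = Suc (card (nonnbrs x) + card ?N)" using N nonnbrs by (simp add: card_Un_disjoint)
    finally have "?n = Suc (card (nonnbrs x) + card ?N)" .
    then show ?thesis by (simp add: G.degree_eq_card_neighbours)
  qed
  have "(\<Sum>x\<in>pverts G. card (nonnbrs x) + degree G x + 1) = (\<Sum>x\<in>pverts G. ?n)"
    using co_deg by (rule sum.cong[OF refl])
  then have total: "(\<Sum>x\<in>pverts G. card (nonnbrs x)) + card (parcs G) + ?n = ?n * ?n"
    by (simp only: sum.distrib sum_constant G.sum_degree of_nat_id mult_1_right)
  then have total': "real (\<Sum>x\<in>pverts G. card (nonnbrs x)) + real (card (parcs G)) + real ?n = real ?n * real ?n"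
    by (metis of_nat_add of_nat_mult)
  have gt: "(real k - 1) * real ?n < real (card (parcs G))"
    using card_arcs_gt assms(1,2) k by simp
  have lt: "real (\<Sum>x\<in>pverts G. card (nonnbrs x)) < (real ?n - real k) * real ?n"
    using total' gt by (simp add: algebra_simps)
  then have "0 < (real ?n - real k) * real ?n" by (meson of_nat_0_le_iff le_less_trans)
  then have kn: "k < ?n" by (simp add: zero_less_mult_iff)
  define D where "D = ?n - k"
  have D: "real D = real ?n - real k" "?n = k + D" "1 \<le> D" using kn by (auto simp: D_def)
  have "real D * 10 ^ 11 \<le> real k" using n D(1) by (simp add: field_simps)
  then have "real (D * 10 ^ 11) \<le> real k" by simp
  then have Dk: "D * 10 ^ 11 \<le> k" by (simp only: of_nat_le_iff)
  let ?h = "k div 10000"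
  interpret tree_in_dense_host k par "pverts G" "parcs G" D ?h
  proof unfold_locales
    have "real (\<Sum>x\<in>pverts G. card (nonnbrs x)) < real (D * ?n)" using lt D(1) by simp
    then show "(\<Sum>x\<in>pverts G. card (nonnbrs x)) < D * ?n" by (simp only: of_nat_less_iff)
    show "10000000 * D \<le> ?h" using Dk by (simp add: less_eq_div_iff_mult_less_eq)
  qed (use enc(2) D in auto)
  have "hosts (pverts G) (parcs G) k par"
  proof (rule hosts_dense)
    fix x assume x: "x \<in> pverts G"
    then have "min_degree G \<le> degree G x"
      unfolding min_degree_def using finite_V by (intro Min_le) auto
    with assms(3) have "real k \<le> real (2 * degree G x)" by simp
    then show "k \<le> 2 * card {w \<in> pverts G. (x, w) \<in> parcs G}"
      by (simp only: of_nat_le_iff G.degree_eq_card_neighbours)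
  next
    fix i assume i: "i \<le> k"
    let ?c = "card (children k par i)"
    have "1000 * real ?c \<le> sqrt (real k)" using deg[OF i] by (auto split: if_splits)
    then have "(1000 * real ?c)\<^sup>2 \<le> real k"
      using power_mono[of "1000 * real ?c" "sqrt (real k)" 2] by simp
    then have "real (1000000 * (?c * ?c)) \<le> real k" by (simp add: power2_eq_square)
    then have "1000000 * (?c * ?c) \<le> k" by (simp only: of_nat_le_iff)
    moreover have "?c \<le> ?c * ?c" by simp
    ultimately have "?c * 10000 \<le> k" by linarith
    then show "?c \<le> ?h" by (simp add: less_eq_div_iff_mult_less_eq)
  qed
  moreover have "pair_graph T" using T by (simp add: trees_def is_tree_def)
  ultimately show "contains G T" by (intro hosts_contains[OF assms(1) _ enc(1,3,2)])
qed

lemma contains_almost_bipartite: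
  fixes G :: "'a pair_pre_digraph" and T :: "'b pair_pre_digraph" and \<Delta> :: nat
  assumes "\<Delta> \<ge> 1"
    and "pair_graph G"
    and "average_degree G > real k - 1"
    and k: "8 * \<Delta> ^ 2 \<le> k" and bip: "beta_bipartite (1 / (50 * real \<Delta> ^ 2)) G A B"
    and AB: "real (card A) \<le> (1 + 1 / (25 * real \<Delta> ^ 2)) * real k"
      "real (card B) \<le> (1 + 1 / (25 * real \<Delta> ^ 2)) * real k"
    and T: "T \<in> trees k (real \<Delta>)"
  shows "contains G T"
proof -
  interpret G: pair_graph G by fact
  obtain v par where enc: "bij_betw v {..k} (pverts T)" "\<And>i. i \<in> {1..k} \<Longrightarrow> par i < i"
    "parcs T = (\<Union>i\<in>{1..k}. {(v (par i), v i), (v i, v (par i))})"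
    and deg: "\<And>i. i \<le> k \<Longrightarrow> real (card (children k par i)) + (if i = 0 then 0 else 1) \<le> real \<Delta>"
    by (rule tree_parent_encoding[OF T]) (rule that)
  interpret parent_tree k par using enc(2) by unfold_locales
  from bip have part: "A \<union> B = pverts G" "A \<inter> B = {}"
    and within: "real (edges_within G A + edges_within G B) \<le> 1 / (50 * real \<Delta> ^ 2) * real (card (edges G))"
    by (auto simp: beta_bipartite_def)
  have finAB: "finite A" "finite B" using G.pair_finite_verts finite_Un[of A B] unfolding part(1) by simp_all
  have "1 \<le> \<Delta> ^ 2" using assms(1) by simp
  then have k1: "1 \<le> k" using k by linarith
  have "hosts (pverts G) (parcs G) k par"
  proof (rule hosts_almost_bipartite[OF assms(1) k _ finAB part(2) _ _ AB])
    show "card (children k par i) + (if i = 0 then 0 else 1) \<le> \<Delta>" if "i \<le> k" for i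
      using deg[OF that] by (auto split: if_splits)
    have n: "real (card (pverts G)) = real (card A) + real (card B)"
      using card_Un_disjoint[OF finAB part(2)] part(1) by simp
    let ?\<beta> = "1 / (50 * (real \<Delta>)\<^sup>2)"
    have "1 \<le> (real \<Delta>)\<^sup>2" using assms(1) by (simp add: one_le_power)
    then have "?\<beta> < 1" by (auto simp: divide_less_eq_1)
    then have "0 < 1 - ?\<beta>" by simp
    moreover have "(real k - 1) * (real (card A) + real (card B)) / 2 < real (card (edges G))"
      using card_arcs_gt[OF assms(2,3) k1] n by (simp add: G.card_arcs)
    ultimately have "(1 - ?\<beta>) * ((real k - 1) * (real (card A) + real (card B)) / 2) < (1 - ?\<beta>) * real (card (edges G))"
      by (rule mult_strict_left_mono[rotated])
    also have "\<dots> \<le> real (card (parcs G \<inter> A \<times> B))"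
    proof -
      have "real (card (parcs G \<inter> A \<times> B)) + real (edges_within G A + edges_within G B) = real (card (edges G))"
        using G.card_cross_arcs[OF part] by (simp flip: of_nat_add)
      with within show ?thesis unfolding left_diff_distrib by linarith
    qed
    finally show "(1 - ?\<beta>) * (real k - 1) * (real (card A) + real (card B)) / 2 < real (card (parcs G \<inter> A \<times> B))"
      by (simp add: mult.assoc)
    show "A \<union> B \<subseteq> pverts G" using part(1) by simp
    show "(y, x) \<in> parcs G" if "(x, y) \<in> parcs G" for x y using that by (rule G.arcs_symmetric)
  qed
  moreover have "pair_graph T" using T by (simp add: trees_def is_tree_def)
  ultimately show "contains G T" by (intro hosts_contains[OF assms(2) _ enc(1,3,2)])
qed

theorem theorem1p2:
  fixes k \<Delta> :: nat and G :: "'a pair_pre_digraph"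
  assumes "\<Delta> \<ge> 1"
    and "pair_graph G"
    and "average_degree G > real k - 1"
    and "real (min_degree G) \<ge> real k / 2"
  shows "(k \<ge> 10 ^ 6 \<and> real (card (pverts G)) \<le> (1 + 1 / 10 ^ 11) * real k \<longrightarrow>
            (\<forall>T :: 'b pair_pre_digraph. T \<in> trees k (sqrt (real k) / 1000) \<longrightarrow> contains G T)) \<and>
         (\<forall>A B. k \<ge> 8 * \<Delta> ^ 2 \<and> beta_bipartite (1 / (50 * real \<Delta> ^ 2)) G A B \<and>
            real (card A) \<le> (1 + 1 / (25 * real \<Delta> ^ 2)) * real k \<and>
            real (card B) \<le> (1 + 1 / (25 * real \<Delta> ^ 2)) * real k \<longrightarrow>
            (\<forall>T :: 'b pair_pre_digraph. T \<in> trees k (real \<Delta>) \<longrightarrow> contains G T))"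
proof (intro conjI impI allI; elim conjE)
  fix T :: "'b pair_pre_digraph"
  assume "10 ^ 6 \<le> k" "real (card (pverts G)) \<le> (1 + 1 / 10 ^ 11) * real k"
    "T \<in> trees k (sqrt (real k) / 1000)"
  then show "contains G T" using assms by (intro contains_dense[of G k T]) simp_all
next
  fix A B and T :: "'b pair_pre_digraph"
  assume "8 * \<Delta> ^ 2 \<le> k" "beta_bipartite (1 / (50 * real \<Delta> ^ 2)) G A B"
    "real (card A) \<le> (1 + 1 / (25 * real \<Delta> ^ 2)) * real k"
    "real (card B) \<le> (1 + 1 / (25 * real \<Delta> ^ 2)) * real k"
    "T \<in> trees k (real \<Delta>)"
  then show "contains G T" by (rule contains_almost_bipartite[OF assms(1-3)])
qed

end
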